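(* Let $n$ be a positive integer. Every subgroup $\Delta$ of finite index $n$ in $\pi_1(\mathcal{G}_5)$ is isomorphic to either $\pi_1(\mathcal{G}_5)$ or $\pi_1(\mathcal{G}_3)$ or $\pi_1(\mathcal{G}_2)$ or $\pi_1(\mathcal{G}_1)\cong\mathbb{Z}^3$. The respective numbers of subgroups are $$(i)\quad s_{\pi_1(\mathcal{G}_5),\pi_1(\mathcal{G}_5)}(n)=\sum_{k\mid n,\ (\frac{n}{k},6)=1}k\,\theta(k),$$ $$(ii)\quad s_{\pi_1(\mathcal{G}_3),\pi_1(\mathcal{G}_5)}(n)=\sum_{k\mid\frac{n}{2}}k\,\theta(k)-\sum_{k\mid\frac{n}{6}}k\,\theta(k),$$ $$(iii)\quad s_{\pi_1(\mathcal{G}_2),\pi_1(\mathcal{G}_5)}(n)=\omega\!\left(\frac{n}{3}\right)-\omega\!\left(\frac{n}{6}\right),$$ $$(iv)\quad s_{\mathbb{Z}^3,\pi_1(\mathcal{G}_5)}(n)=\omega\!\left(\frac{n}{6}\right).$$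
   Context: $\mathcal{G}_1,\mathcal{G}_2,\mathcal{G}_3,\mathcal{G}_5$ are closed orientable flat (Euclidean) 3-manifolds: $\mathcal{G}_1$ is the 3-torus, and $H_1(\mathcal{G}_2)=\mathbb{Z}_2\oplus\mathbb{Z}_2\oplus\mathbb{Z}$, $H_1(\mathcal{G}_3)=\mathbb{Z}_3\oplus\mathbb{Z}$, $H_1(\mathcal{G}_5)=\mathbb{Z}$. Their fundamental groups are $\pi_1(\mathcal{G}_1)\cong\mathbb{Z}^3$, $$\pi_1(\mathcal{G}_2)=\langle x,y,z : xyx^{-1}y^{-1}=1,\ zxz^{-1}=x^{-1},\ zyz^{-1}=y^{-1}\rangle,$$ $$\pi_1(\mathcal{G}_3)=\langle x,y,z : xyx^{-1}y^{-1}=1,\ zxz^{-1}=y,\ zyz^{-1}=(xy)^{-1}\rangle,$$ $$\pi_1(\mathcal{G}_5)=\langle \tilde x,\tilde y,\tilde z : \tilde x\tilde y\tilde x^{-1}\tilde y^{-1}=1,\ \tilde z\tilde x\tilde z^{-1}=\tilde x\tilde y,\ \tilde z\tilde y\tilde z^{-1}=\tilde x^{-1}\rangle.$$ For groups $H,G$, $s_{H,G}(n)$ denotes the number of subgroups of index $n$ in $G$ that are isomorphic to $H$. $(a,b)$ denotes the greatest common divisor. Arithmetic functions, for a positive integer $n$: $\sigma_1(n)=\sum_{k\mid n}k$, $\omega(n)=\sum_{k\mid n}k\,\sigma_1(k)$, and $\theta(n)=\sum_{k\mid n}\left(\frac{k}{3}\right)$, where $\left(\frac{k}{3}\right)$ is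 the Legendre symbol ($1,-1,0$ for $k\equiv 1,2,0 \bmod 3$). All sums are over positive divisors. Each of these functions is taken to be $0$ at arguments that are not positive integers, and a sum over $k\mid m$ is $0$ if $m$ is not a positive integer. *)

theory Defs
  imports
    "HOL-Algebra.Algebra"
    "HOL-Number_Theory.Residues"
begin

section \<open>Group presentations\<close>

text \<open>
  Words are lists of signed generators.  A presentation is a set of pairs of words,
  the pair \<open>(r, s)\<close> standing for the defining relation \<open>r = s\<close>; the generators
  are all elements of the type \<open>'g\<close>.
\<close>

datatype 'g letter = Gen 'g | GenInv 'g

inductive pres_eq :: "('g letter list \<times> 'g letter list) set \<Rightarrow>
    'g letter list \<Rightarrow> 'g letter list \<Rightarrow> bool"
  for R where
  refl: "pres_eq R w w"
| sym: "pres_eq R v w \<Longrightarrow> pres_eq R w v"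
| trans: "pres_eq R u v \<Longrightarrow> pres_eq R v w \<Longrightarrow> pres_eq R u w"
| cancel_right: "pres_eq R (u @ [Gen g, GenInv g] @ v) (u @ v)"
| cancel_left: "pres_eq R (u @ [GenInv g, Gen g] @ v) (u @ v)"
| relation: "(r, s) \<in> R \<Longrightarrow> pres_eq R (u @ r @ v) (u @ s @ v)"

definition pres_rel :: "('g letter list \<times> 'g letter list) set \<Rightarrow>
    ('g letter list \<times> 'g letter list) set"
  where "pres_rel R = {(v, w). pres_eq R v w}"

definition presented_group :: "('g letter list \<times> 'g letter list) set \<Rightarrow>
    'g letter list set monoid"
  where "presented_group R =
    \<lparr>carrier = UNIV // pres_rel R,
     monoid.mult = (\<lambda>A B. \<Union>v\<in>A. \<Union>w\<in>B. pres_rel R `` {v @ w}),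
     one = pres_rel R `` {[]}\<rparr>"

lemma equiv_pres_rel: "equiv UNIV (pres_rel R)"
  by (rule equivI)
    (auto simp: pres_rel_def intro!: refl_onI symI transI
       intro: pres_eq.refl pres_eq.sym pres_eq.trans)

lemma pres_eq_context: "pres_eq R v w \<Longrightarrow> pres_eq R (a @ v @ b) (a @ w @ b)"
proof (induction rule: pres_eq.induct)
  case (cancel_right u g v)
  show ?case using pres_eq.cancel_right[of R "a @ u" g "v @ b"] by simp
next
  case (cancel_left u g v)
  show ?case using pres_eq.cancel_left[of R "a @ u" g "v @ b"] by simp
next
  case (relation r s u v)
  then show ?case using pres_eq.relation[of r s R "a @ u" "v @ b"] by simp
qed (blast intro: pres_eq.refl pres_eq.sym pres_eq.trans)+

lemma pres_eq_append:
  assumes "pres_eq R v v'" "pres_eq R w w'"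
  shows "pres_eq R (v @ w) (v' @ w')"
  using pres_eq_context[OF assms(1), of "[]" w] pres_eq_context[OF assms(2), of v' "[]"]
  by (auto intro: pres_eq.trans)

lemma presented_group_mult_class:
  "pres_rel R `` {v} \<otimes>\<^bsub>presented_group R\<^esub> pres_rel R `` {w} = pres_rel R `` {v @ w}"
proof -
  have "(\<lambda>v w. pres_rel R `` {v @ w}) respects2 pres_rel R"
    by (rule congruent2I'[OF equiv_class_eq[OF equiv_pres_rel]])
      (auto simp: pres_rel_def intro: pres_eq_append)
  then show ?thesis
    unfolding presented_group_def
    by (simp add: UN_equiv_class2[OF equiv_pres_rel equiv_pres_rel])
qed

lemma presented_group_left_inv:
  "\<exists>v. pres_eq R (v @ w) []"
proof (induction w)
  case Nil
  show ?case by (auto intro: pres_eq.refl)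
next
  case (Cons a w)
  then obtain v where v: "pres_eq R (v @ w) []" by blast
  show ?case
  proof (cases a)
    case (Gen g)
    then show ?thesis
      using pres_eq.cancel_left[of R v g w] v
      by (intro exI[of _ "v @ [GenInv g]"]) (auto intro: pres_eq.trans)
  next
    case (GenInv g)
    then show ?thesis
      using pres_eq.cancel_right[of R v g w] v
      by (intro exI[of _ "v @ [Gen g]"]) (auto intro: pres_eq.trans)
  qed
qed

lemma group_presented_group: "group (presented_group R)"
proof (rule groupI)
  have carr: "x \<in> carrier (presented_group R) \<longleftrightarrow> (\<exists>w. x = pres_rel R `` {w})" for x
    by (auto simp: presented_group_def quotient_def)
  have one: "\<one>\<^bsub>presented_group R\<^esub> = pres_rel R `` {[]}"
    by (simp add: presented_group_def)
  note ms = presented_group_mult_class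
  show "\<one>\<^bsub>presented_group R\<^esub> \<in> carrier (presented_group R)"
    using carr one by blast
  fix x assume "x \<in> carrier (presented_group R)"
  then obtain u where u: "x = pres_rel R `` {u}" using carr by blast
  show "\<one>\<^bsub>presented_group R\<^esub> \<otimes>\<^bsub>presented_group R\<^esub> x = x"
    by (simp add: u one ms)
  obtain v where "pres_eq R (v @ u) []" using presented_group_left_inv by blast
  then have "pres_rel R `` {v @ u} = pres_rel R `` {[]}"
    by (intro equiv_class_eq[OF equiv_pres_rel]) (simp add: pres_rel_def)
  then show "\<exists>y\<in>carrier (presented_group R). y \<otimes>\<^bsub>presented_group R\<^esub> x = \<one>\<^bsub>presented_group R\<^esub>"
    using carr by (auto simp: u one ms intro!: bexI[of _ "pres_rel R `` {v}"])
  fix y assume "y \<in> carrier (presented_group R)"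
  then obtain v where v: "y = pres_rel R `` {v}" using carr by blast
  show "x \<otimes>\<^bsub>presented_group R\<^esub> y \<in> carrier (presented_group R)"
    using carr by (auto simp: u v ms)
  fix z assume "z \<in> carrier (presented_group R)"
  then obtain w where w: "z = pres_rel R `` {w}" using carr by blast
  show "x \<otimes>\<^bsub>presented_group R\<^esub> y \<otimes>\<^bsub>presented_group R\<^esub> z =
        x \<otimes>\<^bsub>presented_group R\<^esub> (y \<otimes>\<^bsub>presented_group R\<^esub> z)"
    by (simp add: u v w ms)
qed


section \<open>Fundamental groups of the flat 3-manifolds\<close>

datatype gen3 = GX | GY | GZ

definition pi1_G1 :: "(int \<times> int \<times> int) monoid"
  where "pi1_G1 = integer_group \<times>\<times> integer_group \<times>\<times> integer_group"

definition pi1_G2 :: "gen3 letter list set monoid"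
  where "pi1_G2 = presented_group
    {([Gen GX, Gen GY, GenInv GX, GenInv GY], []),
     ([Gen GZ, Gen GX, GenInv GZ], [GenInv GX]),
     ([Gen GZ, Gen GY, GenInv GZ], [GenInv GY])}"

text \<open>Below, \<open>[GenInv GY, GenInv GX]\<close> is the word for the inverse of \<open>xy\<close>.\<close>

definition pi1_G3 :: "gen3 letter list set monoid"
  where "pi1_G3 = presented_group
    {([Gen GX, Gen GY, GenInv GX, GenInv GY], []),
     ([Gen GZ, Gen GX, GenInv GZ], [Gen GY]),
     ([Gen GZ, Gen GY, GenInv GZ], [GenInv GY, GenInv GX])}"

definition pi1_G5 :: "gen3 letter list set monoid"
  where "pi1_G5 = presented_group
    {([Gen GX, Gen GY, GenInv GX, GenInv GY], []),
     ([Gen GZ, Gen GX, GenInv GZ], [Gen GX, Gen GY]),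
     ([Gen GZ, Gen GY, GenInv GZ], [GenInv GX])}"


section \<open>Counting subgroups of given index\<close>

text \<open>
  Since \<open>card\<close> of an infinite set is \<open>0\<close>, this is the set of subgroups of finite
  index \<open>n\<close> only when \<open>n > 0\<close>.
\<close>

definition subgroups_of_index :: "('a, 'b) monoid_scheme \<Rightarrow> nat \<Rightarrow> 'a set set"
  where "subgroups_of_index G n = {D. subgroup D G \<and> card (rcosets\<^bsub>G\<^esub> D) = n}"

definition num_subgroups_iso ::
    "('c, 'd) monoid_scheme \<Rightarrow> ('a, 'b) monoid_scheme \<Rightarrow> nat \<Rightarrow> nat"
  where "num_subgroups_iso H G n =
    card {D \<in> subgroups_of_index G n. G\<lparr>carrier := D\<rparr> \<cong> H}"


section \<open>Arithmetic functions\<close>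

text \<open>
  All of these vanish at \<open>0\<close>, where the index set of the sum is infinite.
\<close>

definition sigma1 :: "nat \<Rightarrow> nat"
  where "sigma1 n = (\<Sum>k | k dvd n. k)"

definition omega :: "nat \<Rightarrow> nat"
  where "omega n = (\<Sum>k | k dvd n. k * sigma1 k)"

definition theta :: "nat \<Rightarrow> int"
  where "theta n = (\<Sum>k | k dvd n. Legendre (int k) 3)"

text \<open>
  \<open>at_quotient f n m\<close> is the value of \<open>f\<close> at the rational number \<open>n / m\<close>, under the
  convention that \<open>f\<close> vanishes at non-integers.
\<close>

definition at_quotient :: "(nat \<Rightarrow> 'a::zero) \<Rightarrow> nat \<Rightarrow> nat \<Rightarrow> 'a"
  where "at_quotient f n m = (if m dvd n then f (n div m) else 0)"

end

theory Submission
  imports Defs "HOL-Number_Theory.Residue_Primitive_Roots" "HOL-Computational_Algebra.Nth_Powers"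
begin

text \<open>
  Identify \<open>\<langle>x, y\<rangle>\<close> with the Eisenstein integers, so that \<open>z\<close> acts on it by
  multiplication with \<open>\<zeta> = 1 + \<omega>\<close>, a primitive sixth root of unity.  The groups of
  \<open>\<G>\<^sub>5\<close>, \<open>\<G>\<^sub>3\<close>, \<open>\<G>\<^sub>2\<close>, \<open>\<G>\<^sub>1\<close> become
  the semidirect products of the lattice with an infinite cyclic group acting through
  \<open>\<zeta>\<^sup>j\<close>, for \<open>j = 1, 2, 3, 6\<close>.
  A subgroup of index \<open>n\<close> is given by its image \<open>k\<int>\<close> under the projection, its
  intersection \<open>L\<close> with the lattice, which has index \<open>n / k\<close> and is invariant under
  \<open>\<zeta>\<^sup>k\<close>, and one of \<open>n / k\<close> cosets of \<open>L\<close>; its isomorphism type is that of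
  \<open>j = gcd k 6\<close>.  If \<open>3\<close> divides \<open>k\<close>, every \<open>L\<close> is invariant and there are
  \<open>\<sigma>\<^sub>1(n / k)\<close> of them.  Otherwise \<open>L\<close> is an ideal, hence principal, and by
  Hermite normal forms the ideals of index \<open>m\<close> correspond to a divisor \<open>d\<^sup>2\<close> of
  \<open>m\<close> and a root of \<open>t\<^sup>2 - t + 1\<close> modulo \<open>m / d\<^sup>2\<close>; their number is
  multiplicative and equals \<open>\<theta>(m)\<close> by comparison at prime powers.
\<close>

section \<open>Eisenstein integers\<close>

text \<open>The isomorphism type depends on \<open>k\<close> alone for two reasons. Modulo 6, every
  \<open>k\<close> agrees with \<open>gcd k 6\<close> up to sign, and a sign is absorbed by
  inverting the generator of the cyclic factor. Moreover an invariant \<open>L\<close> is isomorphic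
  to the full lattice by a map that commutes with the action: if 3 divides \<open>k\<close>, only
  signs act and any basis gives such a map; otherwise multiplication by a generator of the ideal
  does. This is where principality enters; the count of ideals rests on normal forms. The polynomial
  in the overview is the norm of t + \<omega>: the lattice spanned by \<open>a\<close> and t +
  \<omega> is an ideal exactly if \<open>a\<close> divides this norm. Every coset of
  \<open>L\<close> occurs because the quotient is infinite cyclic and imposes no relation on a lift
  of its generator; hence the factor \<open>n / k\<close>. In the formulas to be proved the
  summation variable is this lattice index, not the \<open>k\<close> of the overview. The four types
  must also be told apart, lest a subgroup be counted twice. The invariant is whether
  \<open>q\<close>-th powers commute with commutators, for \<open>q = 1, 2, 3\<close>.\<close>

datatype eis = Eis (eis_re: int) (eis_om: int)

instantiation eis :: comm_ring_1
begin

definition "0 = Eis 0 0"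
definition "1 = Eis 1 0"
definition "x + y = Eis (eis_re x + eis_re y) (eis_om x + eis_om y)"
definition "- x = Eis (- eis_re x) (- eis_om x)"
definition "x - y = Eis (eis_re x - eis_re y) (eis_om x - eis_om y)"

text \<open>\<^term>\<open>Eis u v\<close> stands for \<open>u + v\<omega>\<close> with \<open>\<omega>\<^sup>2 = - 1 - \<omega>\<close>.\<close>

definition "x * y = Eis (eis_re x * eis_re y - eis_om x * eis_om y)
  (eis_re x * eis_om y + eis_om x * eis_re y - eis_om x * eis_om y)"

instance
proof
  fix x y z :: eis
  show "x * y * z = x * (y * z)" "x * y = y * x" "1 * x = x" "(x + y) * z = x * z + y * z"
    by (cases x; cases y; cases z; simp add: one_eis_def plus_eis_def times_eis_def algebra_simps)+
qed (simp_all add: zero_eis_def one_eis_def plus_eis_def uminus_eis_def minus_eis_def eis.expand)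

end

lemma eis_simps [simp]:
  "Eis a b + Eis c d = Eis (a + c) (b + d)"
  "Eis a b - Eis c d = Eis (a - c) (b - d)"
  "- Eis a b = Eis (- a) (- b)"
  "Eis a b * Eis c d = Eis (a * c - b * d) (a * d + b * c - b * d)"
  "Eis a b = 0 \<longleftrightarrow> a = 0 \<and> b = 0"
  by (simp_all add: zero_eis_def plus_eis_def uminus_eis_def minus_eis_def times_eis_def)

lemma of_nat_eis: "of_nat n = Eis (int n) 0"
  by (induction n) (simp_all add: zero_eis_def one_eis_def)

lemma of_int_eis: "of_int n = Eis n 0"
  by (cases n rule: int_cases2) (simp_all add: of_nat_eis)

definition eis_zeta :: eis where "eis_zeta = Eis 1 1"

text \<open>The exponent is reduced modulo 6 so that negative exponents, needed for inverses in the
  semidirect products, make sense without division in the ring.\<close>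

definition zeta_pow :: "int \<Rightarrow> eis" where "zeta_pow c = eis_zeta ^ nat (c mod 6)"

lemma eis_zeta_pow_6: "eis_zeta ^ 6 = 1"
  by (simp add: eis_zeta_def eval_nat_numeral one_eis_def)

lemma eis_zeta_pow_mod_6: "eis_zeta ^ (n mod 6) = eis_zeta ^ n"
proof -
  have "eis_zeta ^ n = eis_zeta ^ (6 * (n div 6) + n mod 6)" by simp
  also have "\<dots> = eis_zeta ^ (n mod 6)" by (simp only: power_add power_mult eis_zeta_pow_6) simp
  finally show ?thesis by simp
qed

lemma zeta_pow_cong: "c mod 6 = c' mod 6 \<Longrightarrow> zeta_pow c = zeta_pow c'"
  by (simp add: zeta_pow_def)

lemma zeta_pow_add: "zeta_pow (c + c') = zeta_pow c * zeta_pow c'"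
proof -
  have "nat ((c + c') mod 6) = nat ((c mod 6 + c' mod 6) mod 6)"
    by (simp add: mod_add_eq)
  also have "\<dots> = (nat (c mod 6) + nat (c' mod 6)) mod 6"
    by (simp add: nat_mod_distrib nat_add_distrib)
  finally show ?thesis
    unfolding zeta_pow_def by (simp only: eis_zeta_pow_mod_6 power_add)
qed

lemma zeta_pow_simps [simp]:
  "zeta_pow 0 = 1" "zeta_pow 1 = Eis 1 1" "zeta_pow 2 = Eis 0 1" "zeta_pow 3 = - 1"
  "zeta_pow 4 = Eis (-1) (-1)" "zeta_pow 5 = Eis 0 (-1)"
  by (simp_all add: zeta_pow_def eis_zeta_def eval_nat_numeral one_eis_def)

lemma zeta_pow_minus: "zeta_pow (- c) * zeta_pow c = 1"
  by (metis add.left_inverse zeta_pow_add zeta_pow_simps(1))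

lemma zeta_pow_minus_mult [simp]: "zeta_pow (- c) * (zeta_pow c * w) = w"
  by (simp only: zeta_pow_minus mult_1 mult.assoc[symmetric])

lemma zeta_pow_minus_mult' [simp]: "zeta_pow c * (zeta_pow (- c) * w) = w"
  using zeta_pow_minus_mult[of "- c" w] by (simp only: minus_minus)

section \<open>Semidirect products with an infinite cyclic group\<close>

text \<open>The generator \<open>(0, 1)\<close> acts on the first component by \<zeta>^j. All
  \<open>j\<close> share one carrier, and \<open>j = 6\<close> gives the trivial action, so the four
  model groups differ in the parameter alone.\<close>

definition eis_group :: "int \<Rightarrow> (eis \<times> int) monoid"
  where "eis_group j = \<lparr>carrier = UNIV,
    monoid.mult = (\<lambda>(w, c) (w', c'). (w + zeta_pow (j * c) * w', c + c')), one = (0, 0)\<rparr>"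

lemma eis_group_simps [simp]:
  "carrier (eis_group j) = UNIV"
  "(w, c) \<otimes>\<^bsub>eis_group j\<^esub> (w', c') = (w + zeta_pow (j * c) * w', c + c')"
  "\<one>\<^bsub>eis_group j\<^esub> = (0, 0)"
  by (simp_all add: eis_group_def)

lemma group_eis_group: "group (eis_group j)"
proof (rule groupI)
  fix x y z :: "eis \<times> int"
  show "x \<otimes>\<^bsub>eis_group j\<^esub> y \<otimes>\<^bsub>eis_group j\<^esub> z = x \<otimes>\<^bsub>eis_group j\<^esub> (y \<otimes>\<^bsub>eis_group j\<^esub> z)"
    by (cases x; cases y; cases z) (simp add: zeta_pow_add distrib_left algebra_simps)
  show "\<exists>y\<in>carrier (eis_group j). y \<otimes>\<^bsub>eis_group j\<^esub> x = \<one>\<^bsub>eis_group j\<^esub>"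
    by (cases x) (rule bexI[of _ "(- zeta_pow (- (j * snd x)) * fst x, - snd x)"]; simp)
  show "\<one>\<^bsub>eis_group j\<^esub> \<otimes>\<^bsub>eis_group j\<^esub> x = x"
    by (cases x) simp
qed auto

interpretation eis_group: group "eis_group j" for j
  by (rule group_eis_group)

lemma eis_group_inv: "inv\<^bsub>eis_group j\<^esub> (w, c) = (- zeta_pow (- (j * c)) * w, - c)"
  by (rule eis_group.inv_equality) simp_all

lemma eis_group_snd_mult: "snd (g \<otimes>\<^bsub>eis_group j\<^esub> h) = snd g + snd h"
  by (cases g; cases h) simp

lemma eis_group_snd_inv: "snd (inv\<^bsub>eis_group j\<^esub> g) = - snd g"
  by (cases g) (simp add: eis_group_inv)

lemma eis_group_pow_snd: "snd (g [^]\<^bsub>eis_group j\<^esub> (m::nat)) = int m * snd g"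
  by (induction m) (simp_all add: eis_group_snd_mult distrib_right)

lemma eis_group_int_pow_snd: "snd (g [^]\<^bsub>eis_group j\<^esub> (m::int)) = m * snd g"
  by (cases m rule: int_cases2)
    (simp_all only: int_pow_int eis_group.int_pow_neg_int eis_group_snd_inv eis_group_pow_snd
      eis_group_simps UNIV_I mult_minus_left)

lemma eis_group_translation_pow: "(w, 0) [^]\<^bsub>eis_group j\<^esub> (m::nat) = (of_nat m * w, 0)"
  by (induction m) (simp_all add: algebra_simps)

lemma eis_group_int_translation_pow: "(w, 0) [^]\<^bsub>eis_group j\<^esub> (m::int) = (of_int m * w, 0)"
  by (cases m rule: int_cases2)
    (simp_all only: int_pow_int eis_group.int_pow_neg_int eis_group_translation_pow eis_group_inv
      eis_group_simps UNIV_I, simp_all)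

lemma eis_group_screw_pow: "(0, c) [^]\<^bsub>eis_group j\<^esub> (m::nat) = (0, int m * c)"
  by (induction m) (simp_all add: algebra_simps)

lemma eis_group_int_screw_pow: "(0, c) [^]\<^bsub>eis_group j\<^esub> (m::int) = (0, m * c)"
  by (cases m rule: int_cases2)
    (simp_all only: int_pow_int eis_group.int_pow_neg_int eis_group_screw_pow eis_group_inv
      eis_group_simps UNIV_I, simp_all)

section \<open>Presentations\<close>

primrec letter_val :: "('a, 'b) monoid_scheme \<Rightarrow> ('g \<Rightarrow> 'a) \<Rightarrow> 'g letter \<Rightarrow> 'a" where
  "letter_val G f (Gen g) = f g"
| "letter_val G f (GenInv g) = inv\<^bsub>G\<^esub> (f g)"

primrec word_val :: "('a, 'b) monoid_scheme \<Rightarrow> ('g \<Rightarrow> 'a) \<Rightarrow> 'g letter list \<Rightarrow> 'a" where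
  "word_val G f [] = \<one>\<^bsub>G\<^esub>"
| "word_val G f (l # w) = letter_val G f l \<otimes>\<^bsub>G\<^esub> word_val G f w"

lemma (in group) letter_val_closed [simp]:
  "range f \<subseteq> carrier G \<Longrightarrow> letter_val G f l \<in> carrier G"
  by (cases l) auto

lemma (in group) word_val_closed [simp]:
  "range f \<subseteq> carrier G \<Longrightarrow> word_val G f w \<in> carrier G"
  by (induction w) auto

lemma (in group) word_val_append:
  "range f \<subseteq> carrier G \<Longrightarrow> word_val G f (v @ w) = word_val G f v \<otimes> word_val G f w"
  by (induction v) (auto simp: m_assoc)

text \<open>Every generating step of \<open>pres_eq\<close> preserves values: cancellation by the
  group laws, a relation by assumption. Evaluation therefore descends to the presented
  group.\<close>

lemma (in group) word_val_pres_eq: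
  assumes "range f \<subseteq> carrier G" "\<And>r s. (r, s) \<in> R \<Longrightarrow> word_val G f r = word_val G f s"
    and "pres_eq R v w"
  shows "word_val G f v = word_val G f w"
  using assms(3)
proof (induction rule: pres_eq.induct)
  case (cancel_right u g v)
  have "f g \<in> carrier G" using assms(1) by auto
  then show ?case using assms(1) by (simp add: word_val_append m_assoc[symmetric])
next
  case (cancel_left u g v)
  have "f g \<in> carrier G" using assms(1) by auto
  then show ?case using assms(1) by (simp add: word_val_append m_assoc[symmetric])
next
  case (relation r s u v)
  then show ?case using assms(1,2) by (simp add: word_val_append)
qed auto

definition word_class :: "('g letter list \<times> 'g letter list) set \<Rightarrow> 'g letter list
    \<Rightarrow> 'g letter list set"
  where "word_class R w = pres_rel R `` {w}"

lemma carrier_presented_group: "carrier (presented_group R) = range (word_class R)"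
  by (auto simp: presented_group_def quotient_def word_class_def)

lemma word_class_closed [simp]: "word_class R w \<in> carrier (presented_group R)"
  by (simp add: carrier_presented_group)

lemma word_class_append:
  "word_class R (v @ w) = word_class R v \<otimes>\<^bsub>presented_group R\<^esub> word_class R w"
  by (simp add: word_class_def presented_group_mult_class)

lemma word_class_Nil: "word_class R [] = \<one>\<^bsub>presented_group R\<^esub>"
  by (simp add: word_class_def presented_group_def)

lemma word_class_eq_iff: "word_class R v = word_class R w \<longleftrightarrow> pres_eq R v w"
  unfolding word_class_def
  by (subst eq_equiv_class_iff[OF equiv_pres_rel]) (simp_all add: pres_rel_def)

lemma word_class_GenInv:
  "word_class R [GenInv g] = inv\<^bsub>presented_group R\<^esub> word_class R [Gen g]"
proof -
  interpret group "presented_group R" by (rule group_presented_group)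
  have "word_class R [GenInv g] \<otimes>\<^bsub>presented_group R\<^esub> word_class R [Gen g] = word_class R []"
    using pres_eq.cancel_left[of R "[]" g "[]"]
    by (simp add: word_class_eq_iff flip: word_class_append)
  then show ?thesis
    by (intro inv_equality[symmetric]) (simp_all add: word_class_Nil)
qed

lemma word_class_eq_word_val:
  "word_class R w = word_val (presented_group R) (\<lambda>g. word_class R [Gen g]) w"
proof (induction w)
  case (Cons l w)
  have "word_class R [l] = letter_val (presented_group R) (\<lambda>g. word_class R [Gen g]) l"
    by (cases l) (simp_all add: word_class_GenInv)
  with Cons word_class_append[of R "[l]" w] show ?case by simp
qed (simp add: word_class_Nil)

lemma word_val_relation:
  "(r, s) \<in> R \<Longrightarrow> word_val (presented_group R) (\<lambda>g. word_class R [Gen g]) r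
    = word_val (presented_group R) (\<lambda>g. word_class R [Gen g]) s"
  using pres_eq.relation[of r s R "[]" "[]"]
  by (simp add: word_class_eq_iff flip: word_class_eq_word_val)

definition presented_group_lift ::
    "('a, 'b) monoid_scheme \<Rightarrow> ('g \<Rightarrow> 'a) \<Rightarrow> 'g letter list set \<Rightarrow> 'a"
  where "presented_group_lift G f A = word_val G f (SOME w. w \<in> A)"

lemma (in group) presented_group_lift_class:
  assumes "range f \<subseteq> carrier G" "\<And>r s. (r, s) \<in> R \<Longrightarrow> word_val G f r = word_val G f s"
  shows "presented_group_lift G f (word_class R w) = word_val G f w"
proof -
  have "w \<in> word_class R w" by (simp add: word_class_def pres_rel_def pres_eq.refl)
  then have "(SOME v. v \<in> word_class R w) \<in> word_class R w" by (rule someI)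
  then have "pres_eq R w (SOME v. v \<in> word_class R w)"
    by (simp add: word_class_def pres_rel_def)
  with assms show ?thesis
    unfolding presented_group_lift_def by (metis word_val_pres_eq)
qed

text \<open>Von Dyck's theorem; it supplies the map from a presented group to its model.\<close>

lemma (in group) presented_group_lift_hom:
  assumes "range f \<subseteq> carrier G" "\<And>r s. (r, s) \<in> R \<Longrightarrow> word_val G f r = word_val G f s"
  shows "presented_group_lift G f \<in> hom (presented_group R) G"
proof (rule homI)
  fix x y assume "x \<in> carrier (presented_group R)" "y \<in> carrier (presented_group R)"
  then obtain v w where "x = word_class R v" "y = word_class R w"
    by (auto simp: carrier_presented_group)
  with assms show "presented_group_lift G f x \<in> carrier G"
    "presented_group_lift G f (x \<otimes>\<^bsub>presented_group R\<^esub> y)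
      = presented_group_lift G f x \<otimes> presented_group_lift G f y"
    by (simp_all add: presented_group_lift_class word_val_append flip: word_class_append)
qed

text \<open>The exponents are the coordinates of \<zeta>^j and \<zeta>^j \<omega>, the images of the
  lattice basis under the action, so that one locale covers the three presentations by varying
  \<open>j\<close>.\<close>

locale eis_relations = group +
  fixes x y z and j :: int
  assumes x [simp]: "x \<in> carrier G" and y [simp]: "y \<in> carrier G" and z [simp]: "z \<in> carrier G"
    and xy: "x \<otimes> y = y \<otimes> x"
    and zx: "z \<otimes> x \<otimes> inv z = x [^] eis_re (zeta_pow j) \<otimes> y [^] eis_om (zeta_pow j)"
    and zy: "z \<otimes> y \<otimes> inv z
      = x [^] eis_re (zeta_pow j * Eis 0 1) \<otimes> y [^] eis_om (zeta_pow j * Eis 0 1)"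
begin

definition transl :: "eis \<Rightarrow> 'a" where "transl w = x [^] eis_re w \<otimes> y [^] eis_om w"

lemma transl_closed [simp]: "transl w \<in> carrier G"
  by (simp add: transl_def)

lemma pow_comm: "x [^] (m::int) \<otimes> y [^] (n::int) = y [^] n \<otimes> x [^] m"
proof -
  have "a [^] m \<otimes> b = b \<otimes> a [^] m" if "a \<otimes> b = b \<otimes> a" "a \<in> carrier G" "b \<in> carrier G" for a b and m :: int
  proof (cases m rule: int_cases2)
    case (nonneg n)
    with that show ?thesis by (simp add: group_commutes_pow int_pow_int)
  next
    case (nonpos n)
    have "a [^] n \<otimes> b = b \<otimes> a [^] n" using that by (simp add: group_commutes_pow)
    with that nonpos show ?thesis
      by (simp add: int_pow_neg_int) (metis inv_solve_left' inv_solve_right inv_closed m_assoc m_closed nat_pow_closed)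
  qed
  \<comment> \<open>Two passes: \<open>y [^] n\<close> is moved past \<open>x\<close>, then
    \<open>x [^] m\<close> past \<open>y [^] n\<close>.\<close>
  from this[of x "y [^] n" m] this[of y x n] xy show ?thesis by simp
qed

lemma transl_add: "transl (v + w) = transl v \<otimes> transl w"
proof -
  have "transl (v + w) = x [^] eis_re v \<otimes> (x [^] eis_re w \<otimes> y [^] eis_om v) \<otimes> y [^] eis_om w"
    by (simp add: transl_def plus_eis_def int_pow_mult m_assoc)
  also have "\<dots> = x [^] eis_re v \<otimes> (y [^] eis_om v \<otimes> x [^] eis_re w) \<otimes> y [^] eis_om w"
    by (simp only: pow_comm)
  also have "\<dots> = transl v \<otimes> transl w"
    by (simp add: transl_def m_assoc)
  finally show ?thesis .
qed

lemma transl_pow: "transl w [^] (n::int) = transl (of_int n * w)"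
  by (cases w) (simp add: transl_def of_int_eis int_pow_mult_distrib pow_comm int_pow_pow mult.commute)

text \<open>Conjugation by \<open>z\<close> is a homomorphism, so its effect on translations is
  determined by the images of \<open>x\<close> and \<open>y\<close>, which the locale
  prescribes.\<close>

lemma conj_transl: "z \<otimes> transl w \<otimes> inv z = transl (zeta_pow j * w)"
proof -
  let ?k = "\<lambda>g. z \<otimes> g \<otimes> inv z"
  have "inv z \<otimes> (z \<otimes> g) = g" if "g \<in> carrier G" for g
    using that by (simp flip: m_assoc)
  then have k: "?k \<in> hom G G"
    by (intro homI) (simp_all add: m_assoc)
  have "?k (transl w) = ?k x [^] eis_re w \<otimes> ?k y [^] eis_om w"
    unfolding transl_def using k
    by (subst hom_mult[OF k]) (simp_all only: hom_int_pow[OF k _ is_group is_group] x y int_pow_closed)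
  also have "\<dots> = transl (of_int (eis_re w) * zeta_pow j + of_int (eis_om w) * (zeta_pow j * Eis 0 1))"
    by (simp only: zx zy transl_add flip: transl_def transl_pow)
  also have "of_int (eis_re w) * zeta_pow j + of_int (eis_om w) * (zeta_pow j * Eis 0 1)
      = zeta_pow j * (of_int (eis_re w) + of_int (eis_om w) * Eis 0 1)"
    by (simp only: algebra_simps)
  also have "of_int (eis_re w) + of_int (eis_om w) * Eis 0 1 = w"
    by (simp add: of_int_eis)
  finally show ?thesis .
qed

lemma pow_transl_nat: "z [^] (n::nat) \<otimes> transl w = transl (zeta_pow (j * int n) * w) \<otimes> z [^] n"
proof (induction n arbitrary: w)
  case (Suc n)
  have Zt: "z \<otimes> transl w = transl (zeta_pow j * w) \<otimes> z" for w
    by (simp add: m_assoc flip: conj_transl)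
  have "z [^] Suc n \<otimes> transl w = z [^] n \<otimes> transl (zeta_pow j * w) \<otimes> z"
    by (simp add: m_assoc Zt)
  also have "\<dots> = transl (zeta_pow (j * int n) * (zeta_pow j * w)) \<otimes> z [^] Suc n"
    by (simp add: Suc m_assoc)
  also have "zeta_pow (j * int n) * (zeta_pow j * w) = zeta_pow (j * int (Suc n)) * w"
    by (simp add: distrib_left zeta_pow_add mult.assoc mult.left_commute)
  finally show ?case .
qed simp

text \<open>The rule that brings a product into the form translation times power of
  \<open>z\<close>. For negative exponents the natural case is applied to the inversely rotated
  \<open>w\<close> and the power of \<open>z\<close> is moved to the other side.\<close>

lemma pow_transl: "z [^] (c::int) \<otimes> transl w = transl (zeta_pow (j * c) * w) \<otimes> z [^] c"
proof (cases c rule: int_cases2)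
  case (nonneg n)
  then show ?thesis by (simp add: int_pow_int pow_transl_nat)
next
  case (nonpos n)
  have "z [^] n \<otimes> transl (zeta_pow (- (j * int n)) * w) = transl w \<otimes> z [^] n"
    by (simp add: pow_transl_nat)
  then have "inv (z [^] n) \<otimes> transl w = transl (zeta_pow (- (j * int n)) * w) \<otimes> inv (z [^] n)"
    by (metis z inv_closed inv_solve_left inv_solve_right m_assoc m_closed nat_pow_closed transl_closed)
  with nonpos show ?thesis by (simp add: int_pow_neg_int)
qed

end

context eis_relations
begin

text \<open>The candidate for the inverse of the map that von Dyck's theorem provides.\<close>

definition eis_hom :: "eis \<times> int \<Rightarrow> 'a" where "eis_hom p = transl (fst p) \<otimes> z [^] snd p"

lemma eis_hom_mult: "eis_hom (p \<otimes>\<^bsub>eis_group j\<^esub> q) = eis_hom p \<otimes> eis_hom q"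
proof -
  obtain w c w' c' where pq: "p = (w, c)" "q = (w', c')" by fastforce
  have "eis_hom p \<otimes> eis_hom q = transl w \<otimes> (z [^] c \<otimes> transl w') \<otimes> z [^] c'"
    by (simp add: eis_hom_def pq m_assoc)
  also have "\<dots> = eis_hom (p \<otimes>\<^bsub>eis_group j\<^esub> q)"
    by (simp add: eis_hom_def pq pow_transl transl_add int_pow_mult m_assoc)
  finally show ?thesis by simp
qed

lemma eis_hom_hom: "eis_hom \<in> hom (eis_group j) G"
  by (rule homI) (simp_all only: eis_hom_mult, simp add: eis_hom_def)

end

definition eis_gen :: "gen3 \<Rightarrow> eis \<times> int"
  where "eis_gen g = (case g of GX \<Rightarrow> (Eis 1 0, 0) | GY \<Rightarrow> (Eis 0 1, 0) | GZ \<Rightarrow> (0, 1))"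

lemma eis_gen_simps [simp]:
  "eis_gen GX = (Eis 1 0, 0)" "eis_gen GY = (Eis 0 1, 0)" "eis_gen GZ = (0, 1)"
  by (simp_all add: eis_gen_def)

text \<open>The universal property gives \<open>?T\<close> in one direction, the relations give
  \<open>eis_hom\<close> in the other. Comparison on generators yields \<open>T_hom\<close>, hence
  injectivity of \<open>eis_hom\<close>, and \<open>F_val\<close>, hence surjectivity.\<close>

lemma presented_group_iso_eis_group:
  assumes rel: "eis_relations (presented_group R) (word_class R [Gen GX]) (word_class R [Gen GY])
      (word_class R [Gen GZ]) j"
    and val: "\<And>r s. (r, s) \<in> R \<Longrightarrow> word_val (eis_group j) eis_gen r = word_val (eis_group j) eis_gen s"
  shows "presented_group R \<cong> eis_group j"
proof -
  let ?P = "presented_group R"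
  interpret eis_relations ?P "word_class R [Gen GX]" "word_class R [Gen GY]"
    "word_class R [Gen GZ]" j by (rule rel)
  let ?T = "presented_group_lift (eis_group j) eis_gen"
  have T: "?T \<in> hom ?P (eis_group j)"
    by (rule eis_group.presented_group_lift_hom) (simp_all add: val)
  have T_gen: "?T (word_class R [Gen g]) = eis_gen g" for g
  proof -
    have "?T (word_class R [Gen g]) = word_val (eis_group j) eis_gen [Gen g]"
      by (rule eis_group.presented_group_lift_class) (simp_all add: val)
    also have "\<dots> = eis_gen g"
      unfolding word_val.simps letter_val.simps by (rule eis_group.r_one) simp
    finally show ?thesis .
  qed
  interpret T: group_hom ?P "eis_group j" ?T
    by (intro group_hom.intro group_hom_axioms.intro T group_eis_group is_group)
  have T_hom: "?T (eis_hom p) = p" for p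
  proof -
    have "?T (eis_hom p) = (Eis 1 0, 0) [^]\<^bsub>eis_group j\<^esub> eis_re (fst p) \<otimes>\<^bsub>eis_group j\<^esub>
        (Eis 0 1, 0) [^]\<^bsub>eis_group j\<^esub> eis_om (fst p) \<otimes>\<^bsub>eis_group j\<^esub> (0, 1) [^]\<^bsub>eis_group j\<^esub> snd p"
      unfolding eis_hom_def transl_def
      by (simp only: T.hom_mult T.hom_int_pow T_gen x y z m_closed int_pow_closed eis_gen_simps)
    then show ?thesis
      by (cases p; cases "fst p") (simp add: eis_group_int_translation_pow
          eis_group_int_screw_pow of_int_eis)
  qed
  interpret F: group_hom "eis_group j" ?P eis_hom
    by (intro group_hom.intro group_hom_axioms.intro eis_hom_hom group_eis_group is_group)
  have F_gen: "eis_hom (eis_gen g) = word_class R [Gen g]" for g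
    by (cases g) (simp_all add: eis_hom_def transl_def zero_eis_def)
  have F_val: "eis_hom (word_val (eis_group j) eis_gen w) = word_class R w" for w
  proof (induction w)
    case Nil
    show ?case by (simp only: word_val.simps F.hom_one word_class_Nil)
  next
    case (Cons l w)
    have "eis_hom (letter_val (eis_group j) eis_gen l) = word_class R [l]"
    proof (cases l)
      case (GenInv g)
      have "eis_hom (inv\<^bsub>eis_group j\<^esub> (eis_gen g)) = inv\<^bsub>?P\<^esub> eis_hom (eis_gen g)"
        by (rule F.hom_inv) simp
      with GenInv show ?thesis by (simp only: letter_val.simps F_gen word_class_GenInv)
    qed (simp only: letter_val.simps F_gen)
    moreover have "word_class R (l # w) = word_class R [l] \<otimes>\<^bsub>?P\<^esub> word_class R w"
      using word_class_append[of R "[l]" w] by simp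
    ultimately show ?case
      by (simp only: word_val.simps eis_hom_mult Cons)
  qed
  have "bij_betw eis_hom (carrier (eis_group j)) (carrier ?P)"
  proof (rule bij_betwI')
    fix p q show "(eis_hom p = eis_hom q) = (p = q)" by (metis T_hom)
    show "eis_hom p \<in> carrier ?P" by (rule F.hom_closed) simp
  next
    fix A assume "A \<in> carrier ?P"
    then obtain w where "A = word_class R w" by (auto simp: carrier_presented_group)
    then have "A = eis_hom (word_val (eis_group j) eis_gen w)" by (simp only: F_val)
    then show "\<exists>p\<in>carrier (eis_group j). A = eis_hom p" by (rule bexI) simp
  qed
  with eis_hom_hom have "eis_hom \<in> iso (eis_group j) ?P" by (rule isoI)
  then have "eis_group j \<cong> ?P" by (rule is_isoI)
  then show ?thesis by (rule eis_group.iso_sym)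
qed

text \<open>The common shape of the three presentations. The premise on \<open>r\<close> and
  \<open>s\<close> speaks of arbitrary groups in which the images of \<open>GX\<close> and
  \<open>GY\<close> commute, so that the words can be evaluated without touching the
  quotient.\<close>

lemma split_presentation_iso_eis_group:
  fixes r s :: "gen3 letter list" and j :: int
  defines "R \<equiv> {([Gen GX, Gen GY, GenInv GX, GenInv GY], []),
      ([Gen GZ, Gen GX, GenInv GZ], r), ([Gen GZ, Gen GY, GenInv GZ], s)}"
  assumes rs: "\<And>(P :: gen3 letter list set monoid) f. \<lbrakk>group P; f GX \<in> carrier P; f GY \<in> carrier P;
      f GX \<otimes>\<^bsub>P\<^esub> f GY = f GY \<otimes>\<^bsub>P\<^esub> f GX\<rbrakk> \<Longrightarrow>
      word_val P f r = f GX [^]\<^bsub>P\<^esub> eis_re (zeta_pow j) \<otimes>\<^bsub>P\<^esub> f GY [^]\<^bsub>P\<^esub> eis_om (zeta_pow j) \<and>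
      word_val P f s = f GX [^]\<^bsub>P\<^esub> eis_re (zeta_pow j * Eis 0 1)
        \<otimes>\<^bsub>P\<^esub> f GY [^]\<^bsub>P\<^esub> eis_om (zeta_pow j * Eis 0 1)"
    and val: "word_val (eis_group j) eis_gen r = (zeta_pow j, 0)"
      "word_val (eis_group j) eis_gen s = (zeta_pow j * Eis 0 1, 0)"
  shows "presented_group R \<cong> eis_group j"
proof -
  define P where "P = presented_group R"
  interpret group P unfolding P_def by (rule group_presented_group)
  define f where "f = (\<lambda>g. word_class R [Gen g])"
  have cl [simp]: "f g \<in> carrier P" for g
    by (simp add: f_def P_def)
  have rel: "word_val P f v = word_val P f w" if "(v, w) \<in> R" for v w
    using word_val_relation[OF that] by (simp only: f_def P_def)
  have "f GX \<otimes>\<^bsub>P\<^esub> (f GY \<otimes>\<^bsub>P\<^esub> (inv\<^bsub>P\<^esub> f GX \<otimes>\<^bsub>P\<^esub> inv\<^bsub>P\<^esub> f GY)) = \<one>\<^bsub>P\<^esub>"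
    using rel[of "[Gen GX, Gen GY, GenInv GX, GenInv GY]" "[]"] by (simp add: R_def)
  then have "f GX \<otimes>\<^bsub>P\<^esub> f GY \<otimes>\<^bsub>P\<^esub> inv\<^bsub>P\<^esub> (f GY \<otimes>\<^bsub>P\<^esub> f GX) = \<one>\<^bsub>P\<^esub>"
    by (simp add: inv_mult_group m_assoc)
  then have xy: "f GX \<otimes>\<^bsub>P\<^esub> f GY = f GY \<otimes>\<^bsub>P\<^esub> f GX"
    by (metis cl inv_closed inv_equality inv_inv m_closed)
  have zx: "f GZ \<otimes>\<^bsub>P\<^esub> f GX \<otimes>\<^bsub>P\<^esub> inv\<^bsub>P\<^esub> f GZ = word_val P f r"
    using rel[of "[Gen GZ, Gen GX, GenInv GZ]" r] by (simp add: R_def m_assoc)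
  have zy: "f GZ \<otimes>\<^bsub>P\<^esub> f GY \<otimes>\<^bsub>P\<^esub> inv\<^bsub>P\<^esub> f GZ = word_val P f s"
    using rel[of "[Gen GZ, Gen GY, GenInv GZ]" s] by (simp add: R_def m_assoc)
  have "eis_relations P (f GX) (f GY) (f GZ) j"
    using rs[of P f, OF is_group cl cl xy] zx zy xy by unfold_locales (simp_all only: cl)
  then show ?thesis
    unfolding P_def f_def
  proof (rule presented_group_iso_eis_group)
    fix v w assume "(v, w) \<in> R"
    then consider "v = [Gen GX, Gen GY, GenInv GX, GenInv GY]" "w = []"
      | "v = [Gen GZ, Gen GX, GenInv GZ]" "w = r" | "v = [Gen GZ, Gen GY, GenInv GZ]" "w = s"
      by (auto simp: R_def)
    then show "word_val (eis_group j) eis_gen v = word_val (eis_group j) eis_gen w"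
      by cases (simp_all only: val, simp_all add: eis_group_inv flip: one_eis_def)
  qed
qed

section \<open>The four fundamental groups as semidirect products\<close>

lemma pi1_G5_iso_eis_group: "pi1_G5 \<cong> eis_group 1"
  unfolding pi1_G5_def
proof (rule split_presentation_iso_eis_group)
  fix P :: "gen3 letter list set monoid" and f
  assume "group P" "f GX \<in> carrier P" "f GY \<in> carrier P"
  then interpret group P by simp
  \<comment> \<open>The two right sides are \<zeta> = 1 + \<omega> and \<zeta> \<omega> = -
    1.\<close>
  show "word_val P f [Gen GX, Gen GY] = f GX [^]\<^bsub>P\<^esub> eis_re (zeta_pow 1) \<otimes>\<^bsub>P\<^esub> f GY [^]\<^bsub>P\<^esub> eis_om (zeta_pow 1) \<and>
      word_val P f [GenInv GX] = f GX [^]\<^bsub>P\<^esub> eis_re (zeta_pow 1 * Eis 0 1)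
        \<otimes>\<^bsub>P\<^esub> f GY [^]\<^bsub>P\<^esub> eis_om (zeta_pow 1 * Eis 0 1)"
    using \<open>f GX \<in> carrier P\<close> \<open>f GY \<in> carrier P\<close> by (simp add: int_pow_neg)
qed (simp_all add: eis_group_inv zero_eis_def)

lemma pi1_G3_iso_eis_group: "pi1_G3 \<cong> eis_group 2"
  unfolding pi1_G3_def
proof (rule split_presentation_iso_eis_group)
  fix P :: "gen3 letter list set monoid" and f
  assume P: "group P" "f GX \<in> carrier P" "f GY \<in> carrier P" "f GX \<otimes>\<^bsub>P\<^esub> f GY = f GY \<otimes>\<^bsub>P\<^esub> f GX"
  then interpret group P by simp
  \<comment> \<open>Here \<zeta>^2 \<omega> = - 1 - \<omega>, whose coordinates list
    \<open>x\<close> before \<open>y\<close>, while the relation has the two inverses in the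
    opposite order.\<close>
  have "inv\<^bsub>P\<^esub> f GY \<otimes>\<^bsub>P\<^esub> inv\<^bsub>P\<^esub> f GX = inv\<^bsub>P\<^esub> f GX \<otimes>\<^bsub>P\<^esub> inv\<^bsub>P\<^esub> f GY"
    using P by (simp flip: inv_mult_group)
  then show "word_val P f [Gen GY] = f GX [^]\<^bsub>P\<^esub> eis_re (zeta_pow 2) \<otimes>\<^bsub>P\<^esub> f GY [^]\<^bsub>P\<^esub> eis_om (zeta_pow 2) \<and>
      word_val P f [GenInv GY, GenInv GX] = f GX [^]\<^bsub>P\<^esub> eis_re (zeta_pow 2 * Eis 0 1)
        \<otimes>\<^bsub>P\<^esub> f GY [^]\<^bsub>P\<^esub> eis_om (zeta_pow 2 * Eis 0 1)"
    using P by (simp add: int_pow_neg)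
qed (simp_all add: eis_group_inv zero_eis_def)

lemma pi1_G2_iso_eis_group: "pi1_G2 \<cong> eis_group 3"
  unfolding pi1_G2_def
proof (rule split_presentation_iso_eis_group)
  fix P :: "gen3 letter list set monoid" and f
  assume "group P" "f GX \<in> carrier P" "f GY \<in> carrier P"
  then interpret group P by simp
  show "word_val P f [GenInv GX] = f GX [^]\<^bsub>P\<^esub> eis_re (zeta_pow 3) \<otimes>\<^bsub>P\<^esub> f GY [^]\<^bsub>P\<^esub> eis_om (zeta_pow 3) \<and>
      word_val P f [GenInv GY] = f GX [^]\<^bsub>P\<^esub> eis_re (zeta_pow 3 * Eis 0 1)
        \<otimes>\<^bsub>P\<^esub> f GY [^]\<^bsub>P\<^esub> eis_om (zeta_pow 3 * Eis 0 1)"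
    using \<open>f GX \<in> carrier P\<close> \<open>f GY \<in> carrier P\<close> by (simp add: int_pow_neg one_eis_def)
qed (simp_all add: eis_group_inv zero_eis_def one_eis_def)

lemma pi1_G1_iso_eis_group: "pi1_G1 \<cong> eis_group 6"
proof -
  have "zeta_pow (6 * c) = 1" for c
    using zeta_pow_cong[of "6 * c" 0] by simp
  then have "(\<lambda>(u, v, c). (Eis u v, c)) \<in> hom pi1_G1 (eis_group 6)"
    by (auto intro!: homI simp: pi1_G1_def)
  moreover have "bij_betw (\<lambda>(u, v, c). (Eis u v, c)) (carrier pi1_G1) (carrier (eis_group 6))"
    by (rule bij_betwI[where g = "\<lambda>(w, c). (eis_re w, eis_om w, c)"]) (auto simp: pi1_G1_def)
  ultimately show ?thesis by (intro is_isoI isoI)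
qed

section \<open>Distinguishing the groups\<close>

text \<open>Here \<open>c\<close> is the commutator of \<open>a\<close> and \<open>b\<close>, expressed without inverses.\<close>

definition powers_centralise_commutators :: "nat \<Rightarrow> ('a, 'b) monoid_scheme \<Rightarrow> bool"
  where "powers_centralise_commutators q G \<longleftrightarrow>
    (\<forall>g\<in>carrier G. \<forall>a\<in>carrier G. \<forall>b\<in>carrier G. \<forall>c\<in>carrier G.
      a \<otimes>\<^bsub>G\<^esub> b = c \<otimes>\<^bsub>G\<^esub> (b \<otimes>\<^bsub>G\<^esub> a) \<longrightarrow> g [^]\<^bsub>G\<^esub> q \<otimes>\<^bsub>G\<^esub> c = c \<otimes>\<^bsub>G\<^esub> g [^]\<^bsub>G\<^esub> q)"

text \<open>The property is phrased by products and powers, so an injective homomorphism reflects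
  it.\<close>

lemma powers_centralise_commutators_iso:
  assumes "G \<cong> H" "group G" "group H" "powers_centralise_commutators q H"
  shows "powers_centralise_commutators q G"
  unfolding powers_centralise_commutators_def
proof (intro ballI impI)
  interpret group G by fact
  obtain h where h: "h \<in> iso G H" using assms(1) by (auto simp: is_iso_def)
  then have hom: "h \<in> hom G H" and inj: "inj_on h (carrier G)" by (simp_all add: iso_iff)
  note mult = hom_mult[OF hom]
  fix g a b c
  assume mem: "g \<in> carrier G" "a \<in> carrier G" "b \<in> carrier G" "c \<in> carrier G"
    and eq: "a \<otimes>\<^bsub>G\<^esub> b = c \<otimes>\<^bsub>G\<^esub> (b \<otimes>\<^bsub>G\<^esub> a)"
  then have im: "h g \<in> carrier H" "h a \<in> carrier H" "h b \<in> carrier H" "h c \<in> carrier H"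
    using hom by (auto simp: hom_def)
  have "h a \<otimes>\<^bsub>H\<^esub> h b = h c \<otimes>\<^bsub>H\<^esub> (h b \<otimes>\<^bsub>H\<^esub> h a)"
    using arg_cong[OF eq, of h] mem by (simp add: mult)
  then have "h g [^]\<^bsub>H\<^esub> q \<otimes>\<^bsub>H\<^esub> h c = h c \<otimes>\<^bsub>H\<^esub> h g [^]\<^bsub>H\<^esub> q"
    using assms(4) im unfolding powers_centralise_commutators_def by blast
  then have "h (g [^]\<^bsub>G\<^esub> q \<otimes>\<^bsub>G\<^esub> c) = h (c \<otimes>\<^bsub>G\<^esub> g [^]\<^bsub>G\<^esub> q)"
    using mem by (simp add: mult hom_nat_pow[OF hom _ assms(2,3)])
  then show "g [^]\<^bsub>G\<^esub> q \<otimes>\<^bsub>G\<^esub> c = c \<otimes>\<^bsub>G\<^esub> g [^]\<^bsub>G\<^esub> q"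
    using inj mem by (auto dest: inj_onD)
qed

text \<open>The projection to the cyclic factor kills commutators, so they lie in the lattice, where
  a \<open>q\<close>-th power acts by a power of \<zeta>^(jq) = 1.\<close>

lemma powers_centralise_commutators_eis_groupI:
  assumes "6 dvd j * int q"
  shows "powers_centralise_commutators q (eis_group j)"
  unfolding powers_centralise_commutators_def
proof (intro ballI impI)
  fix g a b c :: "eis \<times> int"
  assume eq: "a \<otimes>\<^bsub>eis_group j\<^esub> b = c \<otimes>\<^bsub>eis_group j\<^esub> (b \<otimes>\<^bsub>eis_group j\<^esub> a)"
  from arg_cong[OF eq, of snd] have c: "snd c = 0"
    by (simp add: eis_group_snd_mult)
  have "snd (g [^]\<^bsub>eis_group j\<^esub> q) = int q * snd g" by (rule eis_group_pow_snd)
  then obtain w where w: "g [^]\<^bsub>eis_group j\<^esub> q = (w, int q * snd g)" by (metis prod.collapse)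
  have "6 dvd j * (int q * snd g)" using assms by (metis dvd_mult2 mult.assoc)
  then have "zeta_pow (j * (int q * snd g)) = 1"
    using zeta_pow_cong[of "j * (int q * snd g)" 0] by (simp add: mod_eq_0_iff_dvd)
  then show "g [^]\<^bsub>eis_group j\<^esub> q \<otimes>\<^bsub>eis_group j\<^esub> c = c \<otimes>\<^bsub>eis_group j\<^esub> g [^]\<^bsub>eis_group j\<^esub> q"
    using c by (cases c) (simp add: w add.commute)
qed

text \<open>The witness is \<open>c = [z, x]\<close> and \<open>g = z\<close>.\<close>

lemma powers_centralise_commutators_eis_groupD:
  assumes "powers_centralise_commutators q (eis_group j)"
  shows "zeta_pow (j * int q) * (zeta_pow j - 1) = zeta_pow j - 1"
proof -
  have "(0, 1) \<otimes>\<^bsub>eis_group j\<^esub> (1, 0) = (zeta_pow j - 1, 0) \<otimes>\<^bsub>eis_group j\<^esub> ((1, 0) \<otimes>\<^bsub>eis_group j\<^esub> (0, 1))"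
    by simp
  then have "(0, 1) [^]\<^bsub>eis_group j\<^esub> q \<otimes>\<^bsub>eis_group j\<^esub> (zeta_pow j - 1, 0)
      = (zeta_pow j - 1, 0) \<otimes>\<^bsub>eis_group j\<^esub> (0, 1) [^]\<^bsub>eis_group j\<^esub> q"
    using assms unfolding powers_centralise_commutators_def by (metis UNIV_I eis_group_simps(1))
  then show ?thesis by (simp add: eis_group_screw_pow)
qed

text \<open>Among \<open>q = 1, 2, 3\<close>, the product with \<open>i\<close> is divisible by 6
  for no \<open>q\<close> if \<open>i = 1\<close>, for 3 if \<open>i = 2\<close>, for 2 if
  \<open>i = 3\<close>, and for all if \<open>i = 6\<close>. The four patterns differ.\<close>

lemma eis_group_iso_imp_eq:
  assumes "eis_group i \<cong> eis_group j" "i \<in> {1, 2, 3, 6}" "j \<in> {1, 2, 3, 6}"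
  shows "i = j"
proof -
  \<comment> \<open>Where divisibility fails, the necessary equation on powers of \<zeta> is refuted
    in coordinates; the exponent 9 comes from \<open>i = q = 3\<close>.\<close>
  have *: "6 dvd i * int q \<longleftrightarrow> powers_centralise_commutators q (eis_group i)"
    if "i \<in> {1, 2, 3, 6}" "q \<in> {1, 2, 3}" for i q
    using that powers_centralise_commutators_eis_groupI[of i q]
      powers_centralise_commutators_eis_groupD[of q i] zeta_pow_cong[of 6 0] zeta_pow_cong[of 9 3]
    by (auto simp: one_eis_def)
  have "eis_group j \<cong> eis_group i" using assms(1) by (rule eis_group.iso_sym)
  then have "6 dvd i * int q \<longleftrightarrow> 6 dvd j * int q" if "q \<in> {1, 2, 3}" for q
    using *[OF assms(2) that] *[OF assms(3) that] assms(1) group_eis_group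
      powers_centralise_commutators_iso by metis
  from this[of 1] this[of 2] this[of 3] show ?thesis
    using assms(2,3) by auto
qed

section \<open>Sublattices\<close>

definition eis_additive :: "eis set \<Rightarrow> bool"
  where "eis_additive L \<longleftrightarrow> 0 \<in> L \<and> (\<forall>v\<in>L. \<forall>w\<in>L. v - w \<in> L)"

lemma eis_additive_zero: "eis_additive L \<Longrightarrow> 0 \<in> L"
  by (simp add: eis_additive_def)

lemma eis_additive_diff: "eis_additive L \<Longrightarrow> v \<in> L \<Longrightarrow> w \<in> L \<Longrightarrow> v - w \<in> L"
  by (simp add: eis_additive_def)

lemma eis_additive_uminus: "eis_additive L \<Longrightarrow> w \<in> L \<Longrightarrow> - w \<in> L"
  using eis_additive_diff[of L 0 w] eis_additive_zero[of L] by simp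

lemma eis_additive_add: "eis_additive L \<Longrightarrow> v \<in> L \<Longrightarrow> w \<in> L \<Longrightarrow> v + w \<in> L"
  using eis_additive_diff[of L v "- w"] eis_additive_uminus[of L w] by simp

lemma eis_additive_of_int:
  assumes "eis_additive L" "w \<in> L" shows "of_int n * w \<in> L"
proof -
  have nat: "of_nat n * w \<in> L" for n
    by (induction n) (simp_all add: eis_additive_zero eis_additive_add assms distrib_right)
  show ?thesis
    by (cases n rule: int_cases2) (simp_all add: nat eis_additive_uminus assms(1))
qed

text \<open>The lattice with basis \<open>(a, 0), (b, d)\<close> in Hermite normal form, see \<open>mem_lat\<close>.\<close>

definition lat :: "nat \<Rightarrow> nat \<Rightarrow> nat \<Rightarrow> eis set"
  where "lat a b d = {w. int d dvd eis_om w \<and> int a dvd eis_re w - int b * (eis_om w div int d)}"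

lemma mem_lat:
  assumes "d > 0"
  shows "w \<in> lat a b d \<longleftrightarrow> (\<exists>s t. w = Eis (int a * s + int b * t) (int d * t))"
proof
  assume "w \<in> lat a b d"
  then have "int d dvd eis_om w" "int a dvd eis_re w - int b * (eis_om w div int d)"
    by (simp_all add: lat_def)
  then obtain s t where "eis_om w = int d * t" "eis_re w - int b * (eis_om w div int d) = int a * s"
    by (meson dvdE)
  with assms have "w = Eis (int a * s + int b * t) (int d * t)"
    by (cases w) simp
  then show "\<exists>s t. w = Eis (int a * s + int b * t) (int d * t)" by blast
qed (use assms in \<open>auto simp: lat_def\<close>)

lemma eis_additive_lat:
  assumes "d > 0" shows "eis_additive (lat a b d)"
  unfolding eis_additive_def mem_lat[OF assms]
proof (intro conjI ballI; (elim exE)?)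
  show "\<exists>s t. 0 = Eis (int a * s + int b * t) (int d * t)"
    by (rule exI[of _ 0], rule exI[of _ 0]) (simp add: zero_eis_def)
next
  fix v w assume "v \<in> lat a b d" "w \<in> lat a b d"
  then obtain s t s' t' where "v = Eis (int a * s + int b * t) (int d * t)"
    "w = Eis (int a * s' + int b * t') (int d * t')"
    using mem_lat[OF assms] by metis
  then have "v - w = Eis (int a * (s - s') + int b * (t - t')) (int d * (t - t'))"
    by (simp add: algebra_simps)
  then show "\<exists>s t. v - w = Eis (int a * s + int b * t) (int d * t)" by blast
qed

lemma Eis_mem_lat_0 [simp]: "Eis u 0 \<in> lat a b d \<longleftrightarrow> int a dvd u"
  by (simp add: lat_def)

lemma Eis_mem_lat_basis: "d > 0 \<Longrightarrow> Eis u (int d) \<in> lat a b d \<longleftrightarrow> int a dvd u - int b"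
  by (simp add: lat_def)

text \<open>\<open>d\<close> is the least positive element; remainders modulo \<open>d\<close> stay
  in \<open>S\<close> and hence vanish. It serves both for lattice coordinates and for the
  projection of a subgroup to the cyclic factor.\<close>

lemma int_additive_principal:
  fixes S :: "int set"
  assumes "\<And>x y. x \<in> S \<Longrightarrow> y \<in> S \<Longrightarrow> x - y \<in> S" "x \<in> S" "x \<noteq> 0"
  shows "\<exists>d::nat. d > 0 \<and> S = {y. int d dvd y}"
proof -
  have zero: "0 \<in> S" using assms(1)[OF assms(2,2)] by simp
  have neg: "- y \<in> S" if "y \<in> S" for y using assms(1)[OF zero that] by simp
  have add: "y + z \<in> S" if "y \<in> S" "z \<in> S" for y z
    using assms(1)[OF that(1) neg[OF that(2)]] by simp
  have nat_mult: "int n * y \<in> S" if "y \<in> S" for n y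
    by (induction n) (simp_all add: zero add that distrib_right)
  have mult: "n * y \<in> S" if "y \<in> S" for n y
    by (cases n rule: int_cases2) (simp_all add: nat_mult neg that)
  define d where "d = (LEAST n. n > 0 \<and> int n \<in> S)"
  have "\<bar>x\<bar> \<in> S" using assms(2) neg by (auto simp: abs_if)
  then have "\<exists>n. n > 0 \<and> int n \<in> S" using assms(3) by (intro exI[of _ "nat \<bar>x\<bar>"]) simp
  then have d: "d > 0" "int d \<in> S" using LeastI_ex[of "\<lambda>n. n > 0 \<and> int n \<in> S"] by (auto simp: d_def)
  have least: "d \<le> n" if "n > 0" "int n \<in> S" for n
    unfolding d_def by (rule Least_le) (use that in simp)
  have "int d dvd y" if "y \<in> S" for y
  proof -
    have "y mod int d = y - (y div int d) * int d" by (simp add: minus_div_mult_eq_mod)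
    then have "y mod int d \<in> S" using assms(1)[OF that mult[OF d(2)]] by simp
    moreover have "0 \<le> y mod int d" "y mod int d < int d" using d(1) by simp_all
    ultimately have "y mod int d = 0"
      using least[of "nat (y mod int d)"] by (cases "y mod int d = 0") simp_all
    then show ?thesis by (simp add: dvd_eq_mod_eq_0)
  qed
  moreover have "y \<in> S" if "int d dvd y" for y
    using that mult[OF d(2)] by (auto simp: mult.commute elim!: dvdE)
  ultimately show ?thesis using d(1) by blast
qed

text \<open>\<open>a\<close> generates the part of \<open>L\<close> on the axis of the first
  coordinate, \<open>d\<close> the projection to the second, and \<open>b\<close> completes
  \<open>d\<close> to an element of \<open>L\<close>, reduced modulo \<open>a\<close>. The two given
  elements express that \<open>L\<close> has full rank.\<close>

lemma eis_additive_hnf: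
  assumes L: "eis_additive L" and "Eis A 0 \<in> L" "A \<noteq> 0" "Eis U V \<in> L" "V \<noteq> 0"
  shows "\<exists>a b d. a > 0 \<and> d > 0 \<and> b < a \<and> L = lat a b d"
proof -
  have "x - y \<in> {u. Eis u 0 \<in> L}" if "x \<in> {u. Eis u 0 \<in> L}" "y \<in> {u. Eis u 0 \<in> L}" for x y
    using that eis_additive_diff[OF L, of "Eis x 0" "Eis y 0"] by simp
  from int_additive_principal[OF this, of A] assms(2,3)
  obtain a :: nat where a: "a > 0" "\<And>u. Eis u 0 \<in> L \<longleftrightarrow> int a dvd u" by auto
  have "x - y \<in> {v. \<exists>u. Eis u v \<in> L}" if xy: "x \<in> {v. \<exists>u. Eis u v \<in> L}" "y \<in> {v. \<exists>u. Eis u v \<in> L}" for x y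
  proof -
    from xy obtain u u' where "Eis u x \<in> L" "Eis u' y \<in> L" by blast
    from eis_additive_diff[OF L this] show ?thesis by auto
  qed
  from int_additive_principal[OF this, of V] assms(4,5)
  obtain d :: nat where d: "d > 0" "\<And>v. (\<exists>u. Eis u v \<in> L) \<longleftrightarrow> int d dvd v" by auto
  from d(2)[of "int d"] obtain b0 where b0: "Eis b0 (int d) \<in> L" by auto
  define b where "b = nat (b0 mod int a)"
  have b: "int b = b0 mod int a" "b < a" using a(1) by (simp_all add: b_def nat_less_iff)
  have "int a dvd b0 - int b" by (simp add: b minus_mod_eq_mult_div)
  then have "Eis (b0 - int b) 0 \<in> L" by (simp add: a)
  from eis_additive_diff[OF L b0 this] have bd: "Eis (int b) (int d) \<in> L" by simp
  have "w \<in> L \<longleftrightarrow> w \<in> lat a b d" for w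
  proof (cases w)
    case (Eis u v)
    show ?thesis
    proof (cases "int d dvd v")
      case True
      then obtain t where t: "v = int d * t" by blast
      have bdt: "Eis (int b * t) v \<in> L"
        using eis_additive_of_int[OF L bd, of t] by (simp add: of_int_eis t mult.commute)
      \<comment> \<open>Subtracting \<open>t\<close> copies of the second basis vector reduces
        membership to the axis.\<close>
      have "Eis u v \<in> L \<longleftrightarrow> Eis (u - int b * t) 0 \<in> L"
        using eis_additive_diff[OF L _ bdt, of "Eis u v"] eis_additive_add[OF L _ bdt, of "Eis (u - int b * t) 0"]
        by auto
      then show ?thesis using d(1) by (simp add: Eis a lat_def t)
    next
      case False
      then show ?thesis using d(2)[of v] by (auto simp: Eis lat_def)
    qed
  qed
  with a(1) d(1) b(2) show ?thesis by blast
qed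

section \<open>Coset representatives and uniqueness of the normal form\<close>

lemma eq_if_dvd_diff_less:
  fixes u v a :: nat assumes "int a dvd int u - int v" "u < a" "v < a" shows "u = v"
proof -
  have "[int u = int v] (mod int a)" using assms(1) by (simp add: cong_iff_dvd_diff)
  then have "[u = v] (mod a)" by (simp add: cong_int_iff)
  with assms(2,3) show ?thesis by (simp add: cong_less_modulus_unique_nat)
qed

text \<open>Together with \<open>lat_representative_exists\<close>, the box \<open>u < a\<close>,
  \<open>v < d\<close> meets every coset of the lattice exactly once. The second coordinate is
  compared first, because equality there leaves a difference on the axis.\<close>

lemma lat_representative_unique:
  assumes "Eis (int u) (int v) - Eis (int u') (int v') \<in> lat a b d" "u < a" "u' < a" "v < d" "v' < d"
  shows "u = u'" "v = v'"
proof -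
  from assms have "int d dvd int v - int v'" by (simp add: lat_def)
  with assms show v: "v = v'" by (intro eq_if_dvd_diff_less)
  from assms have "int a dvd int u - int u'" by (simp add: v)
  with assms show "u = u'" by (intro eq_if_dvd_diff_less)
qed

lemma lat_representative_exists:
  assumes "a > 0" "d > 0"
  shows "\<exists>u<a. \<exists>v<d. w - Eis (int u) (int v) \<in> lat a b d"
proof -
  define t where "t = eis_om w div int d"
  define v where "v = nat (eis_om w mod int d)"
  define u where "u = nat ((eis_re w - int b * t) mod int a)"
  have v: "int v = eis_om w mod int d" "v < d" using assms by (simp_all add: v_def nat_less_iff)
  have u: "int u = (eis_re w - int b * t) mod int a" "u < a" using assms by (simp_all add: u_def nat_less_iff)
  have "eis_om w - int v = int d * t" by (simp add: v t_def minus_mod_eq_mult_div)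
  moreover have "int a dvd eis_re w - int u - int b * t"
  proof -
    have "eis_re w - int u - int b * t = (eis_re w - int b * t) - (eis_re w - int b * t) mod int a"
      by (simp add: u)
    then show ?thesis by (simp add: minus_mod_eq_mult_div)
  qed
  ultimately have "w - Eis (int u) (int v) \<in> lat a b d"
    using assms(2) by (cases w) (simp add: lat_def)
  with u v show ?thesis by blast
qed

text \<open>\<open>a\<close> and \<open>d\<close> are intrinsic, as generators of the axis part and
  of the projection; an element above \<open>d\<close> then fixes \<open>b\<close> modulo
  \<open>a\<close>.\<close>

lemma lat_eq_imp:
  assumes "lat a b d = lat a' b' d'" "a > 0" "d > 0" "b < a" "a' > 0" "d' > 0" "b' < a'"
  shows "a = a' \<and> b = b' \<and> d = d'"
proof -
  have "int a dvd u \<longleftrightarrow> int a' dvd u" for u using assms(1) by (metis Eis_mem_lat_0)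
  then have a: "a = a'" by (metis dvd_antisym dvd_refl int_dvd_int_iff)
  have om: "(\<exists>u. Eis u v \<in> lat a b d) \<longleftrightarrow> int d dvd v" if "d > 0" for a b d v
    by (rule iffI, force simp: lat_def) (auto simp: lat_def intro!: exI[of _ "int b * (v div int d)"])
  have "int d dvd v \<longleftrightarrow> int d' dvd v" for v using assms(1,3,6) om by metis
  then have d: "d = d'" by (metis dvd_antisym dvd_refl int_dvd_int_iff)
  have "Eis (int b) (int d) \<in> lat a b d" using assms(3) by (simp add: Eis_mem_lat_basis)
  then have "Eis (int b) (int d') \<in> lat a' b' d'" using assms(1) d by simp
  then have "int a dvd int b - int b'" using assms(6) a by (simp add: Eis_mem_lat_basis)
  with assms a have "b = b'" by (intro eq_if_dvd_diff_less) auto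
  with a d show ?thesis by simp
qed

section \<open>Subgroups of finite index\<close>

text \<open>For \<open>m \<ge> 0\<close> this is the geometric sum of \<open>v\<close> over the
  powers of \<zeta>^k with exponents below \<open>m\<close>. Defining it by a group power covers
  negative \<open>m\<close> and yields the cocycle rule \<open>screw_shift_add\<close> from the
  power laws.\<close>

definition screw_shift :: "nat \<Rightarrow> eis \<Rightarrow> int \<Rightarrow> eis"
  where "screw_shift k v m = fst ((v, int k) [^]\<^bsub>eis_group 1\<^esub> m)"

lemma screw_pow: "(v, int k) [^]\<^bsub>eis_group 1\<^esub> (m::int) = (screw_shift k v m, m * int k)"
  using eis_group_int_pow_snd[where j = 1 and g = "(v, int k)" and m = m]
  by (simp add: screw_shift_def prod_eq_iff)

lemma screw_shift_0 [simp]: "screw_shift k v 0 = 0"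
  by (simp add: screw_shift_def)

lemma screw_shift_1 [simp]: "screw_shift k v 1 = v"
  unfolding screw_shift_def by (subst eis_group.int_pow_1) simp_all

lemma screw_shift_add:
  "screw_shift k v (m + m') = screw_shift k v m + zeta_pow (m * int k) * screw_shift k v m'"
  using eis_group.int_pow_mult[of "(v, int k)" 1 m m'] by (simp add: screw_pow)

lemma screw_shift_minus:
  "screw_shift k v (- m) = - (zeta_pow (- (m * int k)) * screw_shift k v m)"
  using screw_shift_add[of k v "- m" m] by (simp add: eq_neg_iff_add_eq_0)

text \<open>Conjugation by any element with second component \<open>k\<close> multiplies
  translations by \<zeta>^k; the condition says that it maps \<open>L\<close> into itself.\<close>

definition zeta_invariant :: "nat \<Rightarrow> eis set \<Rightarrow> bool"
  where "zeta_invariant k L \<longleftrightarrow> (\<forall>w\<in>L. zeta_pow (int k) * w \<in> L)"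

text \<open>Negative exponents reduce to nonnegative ones because \<zeta> has finite order.\<close>

lemma zeta_invariant_pow:
  assumes "zeta_invariant k L" "w \<in> L"
  shows "zeta_pow (m * int k) * w \<in> L"
proof -
  have nat: "zeta_pow (int n * int k) * w \<in> L" for n
  proof (induction n)
    case (Suc n)
    have "zeta_pow (int k) * (zeta_pow (int n * int k) * w) \<in> L"
      using assms(1) Suc by (simp add: zeta_invariant_def)
    then show ?case by (simp add: distrib_right zeta_pow_add mult.assoc)
  qed (use assms in simp)
  have "zeta_pow (m * int k) = zeta_pow (int (nat (m mod 6)) * int k)"
    by (rule zeta_pow_cong) (simp add: mod_mult_left_eq)
  with nat[of "nat (m mod 6)"] show ?thesis by (simp only:)
qed

text \<open>For an invariant lattice \<open>L\<close> this is the subgroup generated by the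
  translations in \<open>L\<close> and the screw \<open>(v, k)\<close>: its elements are a
  translation times a power of the screw.\<close>

definition screw_subgroup :: "nat \<Rightarrow> eis set \<Rightarrow> eis \<Rightarrow> (eis \<times> int) set"
  where "screw_subgroup k L v = {(w, c). \<exists>m. c = m * int k \<and> w - screw_shift k v m \<in> L}"

lemma screw_subgroupI:
  "w - screw_shift k v m \<in> L \<Longrightarrow> (w, m * int k) \<in> screw_subgroup k L v"
  unfolding screw_subgroup_def by blast

lemma subgroup_screw_subgroup:
  assumes L: "eis_additive L" "zeta_invariant k L"
  shows "subgroup (screw_subgroup k L v) (eis_group 1)"
proof (rule eis_group.subgroupI)
  have "(0, 0) \<in> screw_subgroup k L v"
    using eis_additive_zero[OF L(1)] by (auto simp: screw_subgroup_def intro!: exI[of _ 0])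
  then show "screw_subgroup k L v \<noteq> {}" by blast
next
  fix p assume "p \<in> screw_subgroup k L v"
  then obtain w m where p: "p = (w, m * int k)" "w - screw_shift k v m \<in> L"
    by (auto simp: screw_subgroup_def)
  have "- (zeta_pow (- m * int k) * (w - screw_shift k v m)) \<in> L"
    using p(2) L by (intro eis_additive_uminus zeta_invariant_pow)
  then have "- zeta_pow (- (m * int k)) * w - screw_shift k v (- m) \<in> L"
    by (simp add: screw_shift_minus right_diff_distrib)
  then show "inv\<^bsub>eis_group 1\<^esub> p \<in> screw_subgroup k L v"
    by (auto simp: p(1) eis_group_inv screw_subgroup_def intro!: exI[of _ "- m"])
next
  fix p q assume "p \<in> screw_subgroup k L v" "q \<in> screw_subgroup k L v"
  then obtain w m w' m' where p: "p = (w, m * int k)" "w - screw_shift k v m \<in> L"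
    and q: "q = (w', m' * int k)" "w' - screw_shift k v m' \<in> L"
    by (auto simp: screw_subgroup_def)
  have "(w - screw_shift k v m) + zeta_pow (m * int k) * (w' - screw_shift k v m') \<in> L"
    using p(2) q(2) L by (intro eis_additive_add zeta_invariant_pow)
  then have "w + zeta_pow (m * int k) * w' - screw_shift k v (m + m') \<in> L"
    unfolding screw_shift_add by (simp add: algebra_simps)
  then show "p \<otimes>\<^bsub>eis_group 1\<^esub> q \<in> screw_subgroup k L v"
    by (auto simp: p(1) q(1) screw_subgroup_def distrib_right intro!: exI[of _ "m + m'"])
qed simp

lemma screw_subgroup_translation:
  "k > 0 \<Longrightarrow> (w, 0) \<in> screw_subgroup k L v \<longleftrightarrow> w \<in> L"
  by (auto simp: screw_subgroup_def)

lemma screw_subgroup_snd: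
  "(w, c) \<in> screw_subgroup k L v \<Longrightarrow> int k dvd c"
  by (auto simp: screw_subgroup_def)

lemma screw_subgroup_generator:
  "k > 0 \<Longrightarrow> (w, int k) \<in> screw_subgroup k L v \<longleftrightarrow> w - v \<in> L"
  by (auto simp: screw_subgroup_def intro: exI[of _ 1])

lemma subgroup_eq_screw_subgroup:
  assumes D: "subgroup D (eis_group 1)" and v: "(v, int k) \<in> D"
    and dvd: "\<And>w c. (w, c) \<in> D \<Longrightarrow> int k dvd c"
  shows "D = screw_subgroup k {w. (w, 0) \<in> D} v"
proof -
  interpret D: subgroup D "eis_group 1" by fact
  have pow: "(screw_shift k v m, m * int k) \<in> D" for m
    using eis_group.subgroup_int_pow_closed[OF D v, of m] by (simp add: screw_pow)
  \<comment> \<open>Dividing by the \<open>m\<close>-th power of the chosen screw leaves a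
    translation.\<close>
  have iff: "(w, m * int k) \<in> D \<longleftrightarrow> (w - screw_shift k v m, 0) \<in> D" for w m
  proof
    assume "(w, m * int k) \<in> D"
    then have "(w, m * int k) \<otimes>\<^bsub>eis_group 1\<^esub> inv\<^bsub>eis_group 1\<^esub> (screw_shift k v m, m * int k) \<in> D"
      using pow by (intro D.m_closed D.m_inv_closed)
    then show "(w - screw_shift k v m, 0) \<in> D" by (simp add: eis_group_inv)
  next
    assume "(w - screw_shift k v m, 0) \<in> D"
    then have "(w - screw_shift k v m, 0) \<otimes>\<^bsub>eis_group 1\<^esub> (screw_shift k v m, m * int k) \<in> D"
      using pow by (intro D.m_closed)
    then show "(w, m * int k) \<in> D" by simp
  qed
  show ?thesis
  proof (intro equalityI subsetI)
    fix p assume "p \<in> D"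
    moreover obtain w c where p: "p = (w, c)" by fastforce
    ultimately obtain m where "c = m * int k" using dvd by (metis dvdE mult.commute)
    with \<open>p \<in> D\<close> show "p \<in> screw_subgroup k {w. (w, 0) \<in> D} v"
      by (simp only: p iff) (rule screw_subgroupI, simp)
  next
    fix p assume "p \<in> screw_subgroup k {w. (w, 0) \<in> D} v"
    then obtain w m where "p = (w, m * int k)" "(w - screw_shift k v m, 0) \<in> D"
      unfolding screw_subgroup_def by blast
    then show "p \<in> D" by (simp only: iff)
  qed
qed

lemma subgroup_translations_additive:
  assumes "subgroup D (eis_group j)"
  shows "eis_additive {w. (w, 0) \<in> D}"
proof -
  interpret D: subgroup D "eis_group j" by fact
  have "(v, 0) \<otimes>\<^bsub>eis_group j\<^esub> inv\<^bsub>eis_group j\<^esub> (w, 0) \<in> D" if "(v, 0) \<in> D" "(w, 0) \<in> D" for v w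
    using that by (intro D.m_closed D.m_inv_closed)
  then show ?thesis
    using D.one_closed by (simp add: eis_additive_def eis_group_inv)
qed

lemma subgroup_translations_invariant:
  assumes "subgroup D (eis_group 1)" "(v, int k) \<in> D"
  shows "zeta_invariant k {w. (w, 0) \<in> D}"
proof -
  interpret D: subgroup D "eis_group 1" by fact
  have "(v, int k) \<otimes>\<^bsub>eis_group 1\<^esub> (w, 0) \<otimes>\<^bsub>eis_group 1\<^esub> inv\<^bsub>eis_group 1\<^esub> (v, int k) \<in> D"
    if "(w, 0) \<in> D" for w
    using that assms(2) by (intro D.m_closed D.m_inv_closed)
  then show ?thesis
    by (simp add: zeta_invariant_def eis_group_inv)
qed

text \<open>Pigeonhole: two powers of \<open>g\<close> share a coset, and their quotient lies in
  \<open>D\<close>.\<close>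

lemma (in group) power_mem_finite_index:
  assumes D: "subgroup D G" and fin: "finite (rcosets D)" and g: "g \<in> carrier G"
  shows "\<exists>m::nat. m > 0 \<and> g [^] m \<in> D"
proof -
  interpret D: subgroup D G by fact
  have sub: "(\<lambda>i::nat. D #> g [^] i) ` UNIV \<subseteq> rcosets D"
    using g by (auto intro!: rcosetsI D.subset)
  then have "finite ((\<lambda>i::nat. D #> g [^] i) ` UNIV)"
    using fin finite_subset by blast
  then have "\<not> inj (\<lambda>i::nat. D #> g [^] i)"
    using finite_imageD by blast
  then obtain i j :: nat where ij: "i < j" "D #> g [^] i = D #> g [^] j"
    by (metis (mono_tags, lifting) injI linorder_neqE_nat)
  have "g [^] j \<in> D #> g [^] i"
    using ij(2) g D rcos_self by auto
  then obtain h where h: "h \<in> D" "g [^] j = h \<otimes> g [^] i"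
    by (auto simp: r_coset_def)
  have "g [^] (j - i) \<otimes> g [^] i = h \<otimes> g [^] i"
    using ij(1) g h(2) by (simp add: nat_pow_mult)
  then have "g [^] (j - i) = h"
    using g h(1) by simp
  with ij(1) h(1) show ?thesis by (intro exI[of _ "j - i"]) simp
qed

text \<open>Finite index puts powers of the three generators into \<open>D\<close>: that of
  \<open>(0, 1)\<close> makes the projection nonzero, those of the two basis translations give
  \<open>L\<close> full rank.\<close>

lemma finite_index_screw_subgroup:
  assumes D: "subgroup D (eis_group 1)" and fin: "finite (rcosets\<^bsub>eis_group 1\<^esub> D)"
  shows "\<exists>k a b d p q. k > 0 \<and> a > 0 \<and> d > 0 \<and> b < a \<and> p < a \<and> q < d \<and> zeta_invariant k (lat a b d)
    \<and> D = screw_subgroup k (lat a b d) (Eis (int p) (int q))"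
proof -
  interpret D: subgroup D "eis_group 1" by fact
  note power = eis_group.power_mem_finite_index[OF D fin]
  have "x - y \<in> {c. \<exists>w. (w, c) \<in> D}" if xy: "x \<in> {c. \<exists>w. (w, c) \<in> D}" "y \<in> {c. \<exists>w. (w, c) \<in> D}" for x y
  proof -
    from xy obtain w w' where "(w, x) \<in> D" "(w', y) \<in> D" by blast
    then have "(w, x) \<otimes>\<^bsub>eis_group 1\<^esub> inv\<^bsub>eis_group 1\<^esub> (w', y) \<in> D"
      by (intro D.m_closed D.m_inv_closed)
    then show ?thesis by (auto simp: eis_group_inv)
  qed
  moreover from power[of "(0, 1)"] obtain m where "m > 0" "(0, int m) \<in> D"
    by (auto simp: eis_group_screw_pow)
  ultimately have "\<exists>k>0. {c. \<exists>w. (w, c) \<in> D} = {c. int k dvd c}"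
    by (intro int_additive_principal[of _ "int m"]) auto
  then obtain k :: nat where k: "k > 0" "{c. \<exists>w. (w, c) \<in> D} = {c. int k dvd c}"
    by blast
  then have dvd: "(\<exists>w. (w, c) \<in> D) \<longleftrightarrow> int k dvd c" for c
    by blast
  from dvd[of "int k"] obtain v0 where v0: "(v0, int k) \<in> D" by auto
  define L where "L = {w. (w, 0) \<in> D}"
  from power[of "(Eis 1 0, 0)"] obtain A where "A > 0" "Eis (int A) 0 \<in> L"
    by (auto simp: eis_group_translation_pow of_nat_eis L_def)
  moreover from power[of "(Eis 0 1, 0)"] obtain B where "B > 0" "Eis 0 (int B) \<in> L"
    by (auto simp: eis_group_translation_pow of_nat_eis L_def)
  moreover have L: "eis_additive L"
    unfolding L_def by (rule subgroup_translations_additive[OF D])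
  ultimately obtain a b d where abd: "a > 0" "d > 0" "b < a" "L = lat a b d"
    using eis_additive_hnf[of L "int A" 0 "int B"] by auto
  obtain p q where pq: "p < a" "q < d" "v0 - Eis (int p) (int q) \<in> L"
    using lat_representative_exists[OF abd(1,2), of v0 b] abd(4) by auto
  \<comment> \<open>A translation from \<open>L\<close> moves the lift \<open>v0\<close> to the
    representative of its coset in the box.\<close>
  have "- (v0 - Eis (int p) (int q)) \<in> L" using L pq(3) by (rule eis_additive_uminus)
  then have "(- (v0 - Eis (int p) (int q)), 0) \<otimes>\<^bsub>eis_group 1\<^esub> (v0, int k) \<in> D"
    using v0 by (intro D.m_closed) (simp_all add: L_def)
  then have v: "(Eis (int p) (int q), int k) \<in> D" by simp
  have "D = screw_subgroup k L (Eis (int p) (int q))"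
    unfolding L_def using dvd by (intro subgroup_eq_screw_subgroup[OF D v]) blast
  moreover have "zeta_invariant k L"
    unfolding L_def by (rule subgroup_translations_invariant[OF D v])
  ultimately show ?thesis using k(1) abd pq(1,2) by blast
qed

text \<open>Each parameter is intrinsic: \<open>k\<close> generates the projection, the lattice
  consists of the translations, and \<open>(p, q)\<close> represents the coset of first components
  over \<open>k\<close>.\<close>

lemma screw_subgroup_eq_imp:
  assumes eq: "screw_subgroup k (lat a b d) (Eis (int p) (int q))
      = screw_subgroup k' (lat a' b' d') (Eis (int p') (int q'))"
    and "k > 0" "a > 0" "d > 0" "b < a" "p < a" "q < d"
    and "k' > 0" "a' > 0" "d' > 0" "b' < a'" "p' < a'" "q' < d'"
  shows "k = k' \<and> (a, b, d) = (a', b', d') \<and> (p, q) = (p', q')"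
proof -
  have gen: "(Eis (int p) (int q), int k) \<in> screw_subgroup k (lat a b d) (Eis (int p) (int q))"
    if "k > 0" "d > 0" for k a b d p q
    using that eis_additive_zero[OF eis_additive_lat] by (simp add: screw_subgroup_generator)
  have "int k' dvd int k" "int k dvd int k'"
    using gen[of k d p q a b] gen[of k' d' p' q' a' b'] assms screw_subgroup_snd by metis+
  then have k: "k = k'" by (simp add: dvd_antisym)
  have "lat a b d = lat a' b' d'"
    using screw_subgroup_translation[of k _ "lat a b d"] screw_subgroup_translation[of k' _ "lat a' b' d'"]
      eq assms(2,8) by blast
  from lat_eq_imp[OF this] assms have abd: "a = a'" "b = b'" "d = d'" by auto
  have "Eis (int p) (int q) - Eis (int p') (int q') \<in> lat a b d"
    using gen[of k d p q a b] screw_subgroup_generator[OF assms(2)] eq k abd assms by simp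
  from lat_representative_unique[OF this] assms abd k show ?thesis by auto
qed

lemma screw_subgroup_index:
  assumes "k > 0" "a > 0" "d > 0" and inv: "zeta_invariant k (lat a b d)"
  shows "card (rcosets\<^bsub>eis_group 1\<^esub> (screw_subgroup k (lat a b d) v)) = k * (a * d)"
proof -
  let ?G = "eis_group 1"
  define D where "D = screw_subgroup k (lat a b d) v"
  define rep where "rep = (\<lambda>(c::nat, u::nat, t::nat). (Eis (int u) (int t), int c))"
  let ?R = "{..<k} \<times> {..<a} \<times> {..<d}"
  have D: "subgroup D ?G"
    unfolding D_def using eis_additive_lat[OF assms(3)] inv by (rule subgroup_screw_subgroup)
  interpret D: subgroup D ?G by (rule D)
  have "bij_betw (\<lambda>r. D #>\<^bsub>?G\<^esub> rep r) ?R (rcosets\<^bsub>?G\<^esub> D)"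
  proof (rule bij_betwI')
    fix x y assume "x \<in> ?R" "y \<in> ?R"
    then obtain c u t c' u' t' where xy: "x = (c, u, t)" "y = (c', u', t')"
      "c < k" "u < a" "t < d" "c' < k" "u' < a" "t' < d" by auto
    show "(D #>\<^bsub>?G\<^esub> rep x = D #>\<^bsub>?G\<^esub> rep y) = (x = y)"
    proof
      assume "D #>\<^bsub>?G\<^esub> rep x = D #>\<^bsub>?G\<^esub> rep y"
      then have "rep x \<in> D #>\<^bsub>?G\<^esub> rep y"
        using eis_group.rcos_self[OF _ D, of "rep x"] by simp
      then have "rep x \<otimes>\<^bsub>?G\<^esub> inv\<^bsub>?G\<^esub> rep y \<in> D"
        by (intro D.rcos_module_imp[OF group_eis_group]) simp_all
      then have mem: "(Eis (int u) (int t) - zeta_pow (int c) * (zeta_pow (- int c') * Eis (int u') (int t')),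
          int c - int c') \<in> D"
        by (simp add: rep_def xy eis_group_inv del: eis_simps)
      then have "int k dvd int c - int c'" unfolding D_def by (rule screw_subgroup_snd)
      then have c: "c = c'" using xy by (intro eq_if_dvd_diff_less)
      with mem have "Eis (int u) (int t) - Eis (int u') (int t') \<in> lat a b d"
        using screw_subgroup_translation[OF assms(1)] by (simp add: D_def del: eis_simps)
      from lat_representative_unique[OF this] show "x = y" using c xy by simp
    qed simp
  next
    fix x show "D #>\<^bsub>?G\<^esub> rep x \<in> rcosets\<^bsub>?G\<^esub> D"
      by (intro eis_group.rcosetsI) simp_all
  next
    fix C assume "C \<in> rcosets\<^bsub>?G\<^esub> D"
    then obtain g where C: "C = D #>\<^bsub>?G\<^esub> g" by (auto simp: RCOSETS_def)
    obtain w0 c0 where g: "g = (w0, c0)" by fastforce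
    define m where "m = c0 div int k"
    define c where "c = nat (c0 mod int k)"
    have c: "int c = c0 mod int k" "c < k" using assms(1) by (simp_all add: c_def nat_less_iff)
    have c0: "c0 = m * int k + int c" by (simp add: c m_def)
    \<comment> \<open>The quotient of \<open>g\<close> by a representative over \<open>c\<close>
      lies in \<open>D\<close> iff \<open>w0 - screw_shift k v m\<close> and the representative
      rotated by \<open>zeta_pow (m * int k)\<close> are congruent modulo the lattice. Undoing the
      rotation gives the point to be reduced to the box.\<close>
    define w where "w = zeta_pow (- (m * int k)) * (w0 - screw_shift k v m)"
    obtain u t where ut: "u < a" "t < d" "w - Eis (int u) (int t) \<in> lat a b d"
      using lat_representative_exists[OF assms(2,3), of w b] by blast
    have r: "g \<otimes>\<^bsub>?G\<^esub> inv\<^bsub>?G\<^esub> rep (c, u, t) = (w0 - zeta_pow (m * int k) * Eis (int u) (int t), m * int k)"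
      by (simp add: g rep_def eis_group_inv c0 zeta_pow_add mult.assoc del: eis_simps)
    have w: "zeta_pow (m * int k) * w = w0 - screw_shift k v m"
      by (simp add: w_def)
    have "w0 - zeta_pow (m * int k) * Eis (int u) (int t) - screw_shift k v m
        = zeta_pow (m * int k) * w - zeta_pow (m * int k) * Eis (int u) (int t)"
      unfolding w by (simp only: diff_diff_eq add.commute)
    also have "\<dots> = zeta_pow (m * int k) * (w - Eis (int u) (int t))"
      by (rule right_diff_distrib[symmetric])
    also have "\<dots> \<in> lat a b d"
      by (rule zeta_invariant_pow[OF inv ut(3)])
    finally have "w0 - zeta_pow (m * int k) * Eis (int u) (int t) - screw_shift k v m \<in> lat a b d" .
    then have "g \<otimes>\<^bsub>?G\<^esub> inv\<^bsub>?G\<^esub> rep (c, u, t) \<in> D"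
      unfolding r D_def by (rule screw_subgroupI)
    then have "g \<in> D #>\<^bsub>?G\<^esub> rep (c, u, t)"
      by (intro D.rcos_module_rev[OF group_eis_group]) simp_all
    then have "C = D #>\<^bsub>?G\<^esub> rep (c, u, t)"
      unfolding C by (intro eis_group.repr_independence[symmetric, OF _ _ D]) simp_all
    with c ut show "\<exists>x\<in>?R. C = D #>\<^bsub>?G\<^esub> rep x" by auto
  qed
  then show ?thesis
    using bij_betw_same_card by (fastforce simp: D_def)
qed

hide_const (open) Divisibility.prime

section \<open>Roots of \<open>t\<^sup>2 - t + 1\<close> and the function \<open>\<theta>\<close>\<close>

lemma Legendre_3: "Legendre (int k) 3 = (if k mod 3 = 0 then 0 else if k mod 3 = 1 then 1 else -1)"
proof -
  have "k mod 3 = 0 \<or> k mod 3 = 1 \<or> k mod 3 = 2" by presburger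
  then have k: "int k mod 3 = 0 \<and> k mod 3 = 0 \<or> int k mod 3 = 1 \<and> k mod 3 = 1 \<or> int k mod 3 = 2 \<and> k mod 3 = 2"
    by presburger
  have "y ^ 2 mod 3 \<noteq> 2" for y :: int
  proof -
    have "y mod 3 = 0 \<or> y mod 3 = 1 \<or> y mod 3 = 2" by presburger
    moreover have "y ^ 2 mod 3 = (y mod 3) ^ 2 mod 3" by (simp add: power_mod)
    ultimately show ?thesis by auto
  qed
  moreover have "\<exists>y::int. y ^ 2 mod 3 = 1" by (rule exI[of _ 1]) simp
  ultimately show ?thesis
    using k unfolding Legendre_def QuadRes_def cong_def by (elim disjE conjE) simp_all
qed

lemma Legendre_3_mult: "Legendre (int (a * b)) 3 = Legendre (int a) 3 * Legendre (int b) 3"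
proof -
  have "a mod 3 = 0 \<or> a mod 3 = 1 \<or> a mod 3 = 2" "b mod 3 = 0 \<or> b mod 3 = 1 \<or> b mod 3 = 2"
    by presburger+
  moreover have "a * b mod 3 = (a mod 3) * (b mod 3) mod 3" by (simp add: mod_mult_eq)
  ultimately show ?thesis unfolding Legendre_3 by (elim disjE) simp_all
qed

lemma Legendre_3_power: "Legendre (int (a ^ n)) 3 = Legendre (int a) 3 ^ n"
proof (induction n)
  case (Suc n)
  then show ?case using Legendre_3_mult[of a "a ^ n"] by simp
qed (use Legendre_3[of 1] in simp)

section \<open>Divisor sums over coprime products\<close>

lemma gcd_mult_coprime_dvd:
  fixes i j a b :: nat
  assumes "coprime a b" "i dvd a" "j dvd b"
  shows "gcd (i * j) a = i" "gcd (i * j) b = j"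
proof -
  have "coprime a j" "coprime b i"
    using assms coprime_divisors[of a a j b] coprime_divisors[of i a b b]
    by (simp_all add: coprime_commute)
  then show "gcd (i * j) a = i" "gcd (i * j) b = j"
    using assms(2,3) by (simp_all only: gcd_mult_left_right_cancel gcd_mult_left_left_cancel gcd_nat.absorb1)
qed

lemma gcd_mult_gcd_coprime:
  fixes k a b :: nat
  assumes "coprime a b" "k dvd a * b"
  shows "gcd k a * gcd k b = k"
proof -
  from assms(2) obtain i j where "k = i * j" "i dvd a" "j dvd b"
    by (blast dest: division_decomp)
  then show ?thesis using gcd_mult_coprime_dvd[OF assms(1)] by simp
qed

text \<open>The inverse of \<open>(i, j) \<mapsto> i * j\<close> takes gcds with \<open>a\<close>
  and \<open>b\<close>. An arbitrary summand is allowed so that both \<theta> and the count of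
  ideals are covered.\<close>

lemma sum_divisors_coprime_mult:
  fixes a b :: nat and g :: "nat \<Rightarrow> 'a::comm_monoid_add"
  assumes "coprime a b"
  shows "(\<Sum>k | k dvd a * b. g k) = (\<Sum>i | i dvd a. \<Sum>j | j dvd b. g (i * j))"
proof -
  have "(\<Sum>k | k dvd a * b. g k) = (\<Sum>(i, j) \<in> {i. i dvd a} \<times> {j. j dvd b}. g (i * j))"
    by (rule sum.reindex_bij_witness[where i = "\<lambda>(i, j). i * j" and j = "\<lambda>k. (gcd k a, gcd k b)"])
      (auto simp: gcd_mult_coprime_dvd[OF assms] gcd_mult_gcd_coprime[OF assms] mult_dvd_mono)
  then show ?thesis by (simp add: sum.cartesian_product)
qed

lemma theta_mult:
  assumes "coprime a b"
  shows "theta (a * b) = theta a * theta b"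
  by (simp only: theta_def sum_divisors_coprime_mult[OF assms] sum_product Legendre_3_mult)

text \<open>The polynomial is the sixth cyclotomic one, and also the norm of t + \<omega>.\<close>

definition hexroots :: "nat \<Rightarrow> nat set"
  where "hexroots m = {t. t < m \<and> int m dvd int t ^ 2 - int t + 1}"

lemma finite_hexroots [simp]: "finite (hexroots m)"
  by (rule finite_subset[of _ "{..<m}"]) (auto simp: hexroots_def)

lemma hexpoly_cong:
  assumes "[s = t] (mod m)" shows "(m dvd s ^ 2 - s + 1) = (m dvd t ^ 2 - t + (1::int))"
proof -
  have "[s ^ 2 - s + 1 = t ^ 2 - t + 1] (mod m)"
    using assms by (intro cong_add cong_diff cong_pow cong_refl)
  then show ?thesis by (rule cong_dvd_iff)
qed

lemma card_hexroots_mult: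
  assumes "coprime a b" "a > 0" "b > 0"
  shows "card (hexroots (a * b)) = card (hexroots a) * card (hexroots b)"
proof -
  have "bij_betw (\<lambda>t. (t mod a, t mod b)) (hexroots (a * b)) (hexroots a \<times> hexroots b)"
  proof (rule bij_betwI')
    fix s t assume "s \<in> hexroots (a * b)" "t \<in> hexroots (a * b)"
    then have "s < a * b" "t < a * b" by (simp_all add: hexroots_def)
    then show "((s mod a, s mod b) = (t mod a, t mod b)) = (s = t)"
      using assms by (metis cong_def cong_less_modulus_unique_nat coprime_cong_mult_nat prod.inject)
  next
    fix t assume t: "t \<in> hexroots (a * b)"
    have "[int t = int (t mod m)] (mod int m)" for m
      by (simp add: cong_int_iff)
    from hexpoly_cong[OF this] t assms show "(t mod a, t mod b) \<in> hexroots a \<times> hexroots b"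
      by (auto simp: hexroots_def dest: dvd_mult_left dvd_mult_right)
  next
    fix y assume "y \<in> hexroots a \<times> hexroots b"
    then obtain s t where y: "y = (s, t)" "s \<in> hexroots a" "t \<in> hexroots b" by auto
    from binary_chinese_remainder_unique_nat[OF assms(1), of s t] assms
    obtain x where x: "x < a * b" "[x = s] (mod a)" "[x = t] (mod b)" by auto
    from x have "[int x = int s] (mod int a)" "[int x = int t] (mod int b)" by (simp_all add: cong_int_iff)
    from this[THEN hexpoly_cong] y have "int a dvd int x ^ 2 - int x + 1" "int b dvd int x ^ 2 - int x + 1"
      by (simp_all add: hexroots_def)
    with assms(1) have "int a * int b dvd int x ^ 2 - int x + 1"
      by (intro divides_mult) simp_all
    with x(1) have "x \<in> hexroots (a * b)" by (simp add: hexroots_def)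
    moreover have "y = (x mod a, x mod b)" using x y by (simp add: cong_def hexroots_def)
    ultimately show "\<exists>x\<in>hexroots (a * b). y = (x mod a, x mod b)" by blast
  qed
  then show ?thesis using bij_betw_same_card by (fastforce simp: card_cartesian_product)
qed

section \<open>Roots modulo prime powers\<close>

lemma hexroots_1 [simp]: "hexroots (Suc 0) = {0}"
  by (auto simp: hexroots_def)

text \<open>Modulo 3 the polynomial is (t + 1)^2, so 2 is the only root, and it does not lift: for t
  = 3s + 2 the value is 3 modulo 9.\<close>

lemma card_hexroots_3: "card (hexroots (3 ^ Suc e)) = (if e = 0 then 1 else 0)"
proof (cases e)
  case 0
  have "t \<in> hexroots 3 \<longleftrightarrow> t = 2" for t
  proof (cases "t < 3")
    case True
    then consider "t = 0" | "t = 1" | "t = 2" by linarith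
    then show ?thesis by cases (simp_all add: hexroots_def)
  qed (auto simp: hexroots_def)
  then have "hexroots 3 = {2}" by blast
  with 0 show ?thesis by simp
next
  case (Suc n)
  have "\<not> int (3 ^ Suc e) dvd int t ^ 2 - int t + 1" for t
  proof
    assume dvd: "int (3 ^ Suc e) dvd int t ^ 2 - int t + 1"
    have "(9::int) dvd int (3 ^ Suc e)" by (simp add: Suc)
    with dvd have dvd: "9 dvd int t ^ 2 - int t + 1" by (rule dvd_trans[rotated])
    define s where "s = int t div 3"
    have "int t = 3 * s \<or> int t = 3 * s + 1 \<or> int t = 3 * s + 2" unfolding s_def by presburger
    moreover have "(3 * s) ^ 2 - 3 * s + 1 = 3 * (3 * s ^ 2 - s) + 1"
      "(3 * s + 1) ^ 2 - (3 * s + 1) + 1 = 3 * (3 * s ^ 2 + s) + 1"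
      "(3 * s + 2) ^ 2 - (3 * s + 2) + 1 = 9 * (s ^ 2 + s) + 3"
      by (simp_all add: power2_eq_square algebra_simps)
    ultimately show False using dvd by (elim disjE; simp only:; presburger)
  qed
  then show ?thesis using Suc by (simp add: hexroots_def)
qed

text \<open>A root satisfies t^3 = -1. As p - 1 = 3q + 1, Fermat's theorem then forces t = 1 or t =
  -1 modulo \<open>p\<close>, where the polynomial takes the values 1 and 3.\<close>

lemma hexpoly_prime_dvd_imp:
  assumes p: "prime p" "p mod 3 = 2"
  shows "\<not> int p dvd t ^ 2 - t + 1"
proof
  assume dvd: "int p dvd t ^ 2 - t + 1"
  define q where "q = p div 3"
  have pq: "p - 1 = 3 * q + 1" using p(2) unfolding q_def by presburger
  have ndvd: "\<not> int p dvd t"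
  proof
    assume "int p dvd t"
    then have "int p dvd t ^ 2 - t" by (simp add: power2_eq_square)
    with dvd have "int p dvd 1" by (metis dvd_add_right_iff)
    with p(1) show False by auto
  qed
  define u where "u = nat (t mod int p)"
  have u: "int u = t mod int p" using p(1) by (simp add: u_def prime_gt_0_nat)
  then have cong: "[int u = t] (mod int p)" by (simp add: cong_def)
  have "\<not> p dvd u" using ndvd cong by (metis cong_dvd_iff int_dvd_int_iff)
  then have "[u ^ (p - 1) = 1] (mod p)" by (rule fermat_theorem[OF p(1)])
  then have "[int u ^ (p - 1) = 1] (mod int p)" by (metis cong_int_iff of_nat_1 of_nat_power)
  moreover have "[int u ^ (p - 1) = t ^ (p - 1)] (mod int p)" using cong by (rule cong_pow)
  ultimately have "[t ^ (p - 1) = 1] (mod int p)" by (metis cong_sym cong_trans)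
  then have "[t ^ (3 * q + 1) = 1] (mod int p)" by (simp only: pq)
  then have t1: "[(t ^ 3) ^ q * t = 1] (mod int p)" by (simp only: power_add power_mult power_one_right)
  have "t ^ 3 - (-1) = (t + 1) * (t ^ 2 - t + 1)" by (simp add: power2_eq_square power3_eq_cube algebra_simps)
  with dvd have "[t ^ 3 = -1] (mod int p)" by (simp add: cong_iff_dvd_diff)
  then have "[(t ^ 3) ^ q * t = (-1) ^ q * t] (mod int p)" by (intro cong_mult cong_pow cong_refl)
  with t1 have "[(-1) ^ q * t = 1] (mod int p)" by (metis cong_sym cong_trans)
  then have "[t = 1] (mod int p) \<or> [- t = 1] (mod int p)"
    by (cases "even q") simp_all
  then have "[t = 1] (mod int p) \<or> [t = - 1] (mod int p)"
    using cong_minus_minus_iff[of "- t" 1 "int p"] by auto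
  then have "int p dvd 1 \<or> int p dvd 3"
    using hexpoly_cong[of t 1 "int p"] hexpoly_cong[of t "- 1" "int p"] dvd by auto
  then have "p dvd 1 \<or> p dvd 3" by presburger
  moreover have "prime (3::nat)" by simp
  ultimately have "p = 3" using p(1) primes_dvd_imp_eq by (metis not_prime_unit)
  with p(2) show False by simp
qed

text \<open>A suitable power \<open>h\<close> of a primitive root is a cube root of unity modulo
  \<open>p ^ Suc e\<close> and not 1 modulo \<open>p\<close>; its negative is the root
  sought.\<close>

lemma hexroot_exists:
  assumes p: "prime p" "p mod 3 = 1"
  shows "\<exists>t::int. int (p ^ Suc e) dvd t ^ 2 - t + 1"
proof -
  have "p \<noteq> 2" using p(2) by auto
  then have "odd p" using p(1) prime_odd_nat prime_ge_2_nat by (metis le_neq_implies_less)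
  then obtain g where primroot: "\<forall>k>0. residue_primroot (p ^ k) g"
    using residue_primroot_odd_prime_power_exists[OF p(1)] by blast
  from primroot[rule_format, of 1] have "residue_primroot (p ^ 1) g" by simp
  then have g: "coprime p g" "ord p g = p - 1"
    by (simp_all add: residue_primroot_def totient_prime[OF p(1)])
  define r where "r = (p - 1) div 3"
  have r: "p - 1 = 3 * r" using p(2) unfolding r_def by presburger
  then have "r > 0" using p(1) prime_gt_1_nat[of p] by (cases r) auto
  \<comment> \<open>The exponent is a third of \<open>totient (p ^ Suc e)\<close>.\<close>
  define h where "h = int (g ^ (p ^ e * r))"
  have "[g ^ totient (p ^ Suc e) = 1] (mod p ^ Suc e)"
    using g(1) by (intro euler_theorem) (simp add: coprime_commute)
  moreover have "g ^ totient (p ^ Suc e) = (g ^ (p ^ e * r)) ^ 3"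
    unfolding totient_prime_power_Suc[OF p(1)] r power_mult[symmetric] by (simp add: mult_ac)
  ultimately have "[h ^ 3 = 1] (mod int (p ^ Suc e))"
    unfolding h_def by (metis cong_int_iff of_nat_1 of_nat_power)
  then have "int (p ^ Suc e) dvd h ^ 3 - 1" by (simp add: cong_iff_dvd_diff)
  also have "h ^ 3 - 1 = (h - 1) * (h ^ 2 + h + 1)"
    by (simp add: power2_eq_square power3_eq_cube algebra_simps)
  finally have dvd: "int (p ^ Suc e) dvd (h - 1) * (h ^ 2 + h + 1)" .
  \<comment> \<open>The factor \<open>h - 1\<close> can be cancelled only if it is prime to
    \<open>p\<close>; this follows from the order \<open>3 * r\<close> of \<open>g\<close> modulo
    \<open>p\<close>, as 3 does not divide \<open>p ^ e\<close>.\<close>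
  have "\<not> int p dvd h - 1"
  proof
    assume "int p dvd h - 1"
    then have "[g ^ (p ^ e * r) = 1] (mod p)"
      unfolding h_def by (metis cong_iff_dvd_diff cong_int_iff of_nat_1)
    then have "3 * r dvd p ^ e * r" using ord_divides g(2) r by metis
    then have "3 dvd p ^ e" using \<open>r > 0\<close> by simp
    moreover have "prime (3::nat)" by simp
    ultimately have "3 dvd p" using prime_dvd_power by blast
    with p(2) show False by presburger
  qed
  moreover have "prime (int p)" using p(1) by simp
  ultimately have "coprime (int p) (h - 1)" by (metis prime_imp_coprime)
  then have "coprime (int (p ^ Suc e)) (h - 1)" by simp
  then have "int (p ^ Suc e) dvd h ^ 2 + h + 1"
    using dvd by (simp only: coprime_dvd_mult_right_iff)
  then have "int (p ^ Suc e) dvd (- h) ^ 2 - (- h) + 1" by simp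
  then show ?thesis by blast
qed

text \<open>The roots are \<open>t0\<close> and \<open>1 - t0\<close>. They differ modulo
  \<open>p\<close> because the discriminant is -3, so for any root \<open>t\<close> the whole prime
  power divides one of the two factors of the difference of values.\<close>

lemma card_hexroots_two:
  assumes p: "prime p" "p mod 3 = 1"
  shows "card (hexroots (p ^ Suc e)) = 2"
proof -
  let ?m = "p ^ Suc e"
  have m: "?m > 0" using p(1) by (simp add: prime_gt_0_nat)
  \<comment> \<open>A common zero of the polynomial and its derivative modulo \<open>p\<close> would
    force \<open>p = 3\<close>.\<close>
  have simple: "\<not> (int p dvd 2 * t - 1 \<and> int p dvd t ^ 2 - t + 1)" for t
  proof
    assume "int p dvd 2 * t - 1 \<and> int p dvd t ^ 2 - t + 1"
    then have a: "int p dvd 2 * t - 1" and b: "int p dvd t ^ 2 - t + 1" by simp_all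
    have "int p dvd 4 * (t ^ 2 - t + 1) - (2 * t - 1) * (2 * t - 1)"
      by (rule dvd_diff[OF dvd_mult[OF b] dvd_mult[OF a]])
    also have "4 * (t ^ 2 - t + 1) - (2 * t - 1) * (2 * t - 1) = 3"
      by (simp add: power2_eq_square algebra_simps)
    finally have "p dvd 3" by presburger
    moreover have "prime (3::nat)" by simp
    ultimately have "p = 3" using p(1) primes_dvd_imp_eq by blast
    with p(2) show False by simp
  qed
  obtain t0 where t0: "int ?m dvd t0 ^ 2 - t0 + 1" using hexroot_exists[OF p] by blast
  define red where "red t = nat (t mod int ?m)" for t
  have red: "red t < ?m" "[int (red t) = t] (mod int ?m)" for t
    using m by (simp_all add: red_def nat_less_iff cong_def)
  have pm: "int p dvd int ?m" by simp
  have "red t0 \<in> hexroots ?m"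
    using hexpoly_cong[OF red(2)] t0 red(1) unfolding hexroots_def by blast
  moreover have "red (1 - t0) \<in> hexroots ?m"
  proof -
    have "(1 - t0) ^ 2 - (1 - t0) + 1 = t0 ^ 2 - t0 + 1" by (simp add: power2_eq_square algebra_simps)
    with hexpoly_cong[OF red(2)[of "1 - t0"]] t0 red(1) show ?thesis unfolding hexroots_def by (metis (mono_tags, lifting) mem_Collect_eq)
  qed
  moreover have "t = red t0 \<or> t = red (1 - t0)" if "t \<in> hexroots ?m" for t
  proof -
    from that have t: "t < ?m" "int ?m dvd int t ^ 2 - int t + 1" by (simp_all add: hexroots_def)
    have "int ?m dvd (int t ^ 2 - int t + 1) - (t0 ^ 2 - t0 + 1)" using t(2) t0 by (rule dvd_diff)
    also have "(int t ^ 2 - int t + 1) - (t0 ^ 2 - t0 + 1) = (int t - t0) * (int t - (1 - t0))"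
      by (simp add: power2_eq_square algebra_simps)
    finally have dvd: "int ?m dvd (int t - t0) * (int t - (1 - t0))" .
    have "prime (int p)" using p(1) by simp
    have "\<not> (int p dvd int t - t0 \<and> int p dvd int t - (1 - t0))"
    proof
      assume "int p dvd int t - t0 \<and> int p dvd int t - (1 - t0)"
      then have cd: "int p dvd int t - t0" "int p dvd int t - (1 - t0)" by simp_all
      have "int p dvd (int t - t0) - (int t - (1 - t0))" by (rule dvd_diff[OF cd])
      then have "int p dvd 1 - 2 * t0" by (simp add: algebra_simps)
      then have "int p dvd 2 * t0 - 1" by (metis dvd_minus_iff minus_diff_eq)
      moreover have "int p dvd t0 ^ 2 - t0 + 1" using pm t0 by (rule dvd_trans)
      ultimately show False using simple by blast
    qed
    then have "coprime (int ?m) (int t - t0) \<or> coprime (int ?m) (int t - (1 - t0))"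
      using \<open>prime (int p)\<close> by (metis coprime_power_left_iff of_nat_power prime_imp_coprime)
    then have "int ?m dvd int t - (1 - t0) \<or> int ?m dvd int t - t0"
      using dvd by (metis coprime_dvd_mult_left_iff coprime_dvd_mult_right_iff)
    then have "[int t = int (red (1 - t0))] (mod int ?m) \<or> [int t = int (red t0)] (mod int ?m)"
      using red(2) by (metis cong_iff_dvd_diff cong_sym cong_trans)
    then have "[t = red (1 - t0)] (mod ?m) \<or> [t = red t0] (mod ?m)"
      by (simp only: cong_int_iff)
    then show ?thesis using t(1) red(1) cong_less_modulus_unique_nat by blast
  qed
  ultimately have "hexroots ?m = {red t0, red (1 - t0)}" by blast
  moreover have "red t0 \<noteq> red (1 - t0)"
  proof
    assume "red t0 = red (1 - t0)"
    then have "[t0 = 1 - t0] (mod int ?m)" using red(2) by (metis cong_sym cong_trans)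
    then have "int ?m dvd t0 - (1 - t0)" by (simp only: cong_iff_dvd_diff)
    also have "t0 - (1 - t0) = 2 * t0 - 1" by simp
    finally have "int p dvd 2 * t0 - 1" using pm dvd_trans by blast
    moreover have "int p dvd t0 ^ 2 - t0 + 1" using pm t0 by (rule dvd_trans)
    ultimately show False using simple by blast
  qed
  ultimately show ?thesis by simp
qed

text \<open>One formula for the three residue classes of \<open>p\<close>, with
  \<open>0 ^ 0 = 1\<close> accounting for the single root modulo 3.\<close>

lemma card_hexroots_prime_power:
  assumes "prime p"
  shows "int (card (hexroots (p ^ Suc e))) = Legendre (int p) 3 ^ e * (1 + Legendre (int p) 3)"
proof -
  consider "p mod 3 = 0" | "p mod 3 = 1" | "p mod 3 = 2" by linarith
  then show ?thesis
  proof cases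
    case 1
    moreover have "prime (3::nat)" by simp
    ultimately have "p = 3" using assms primes_dvd_imp_eq by (metis mod_eq_0_iff_dvd)
    then show ?thesis using card_hexroots_3[of e] Legendre_3[of 3] by simp
  next
    case 2
    then show ?thesis using card_hexroots_two[OF assms 2, of e] by (simp add: Legendre_3)
  next
    case 3
    have "\<not> int (p ^ Suc e) dvd int t ^ 2 - int t + 1" for t
      using hexpoly_prime_dvd_imp[OF assms 3, of "int t"] by (metis dvd_trans dvd_triv_left of_nat_dvd_iff power_Suc)
    then have "hexroots (p ^ Suc e) = {}" unfolding hexroots_def by blast
    then show ?thesis using 3 by (simp add: Legendre_3)
  qed
qed

text \<open>A square \<open>k = d ^ 2\<close> records the scaling factor \<open>d\<close> of an
  ideal of index \<open>m\<close>. Summing over all divisors rather than over \<open>d\<close> makes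
  \<open>sum_divisors_coprime_mult\<close> applicable.\<close>

definition hexideals :: "nat \<Rightarrow> nat"
  where "hexideals m = (\<Sum>k | k dvd m. if is_square k then card (hexroots (m div k)) else 0)"

lemma hexideals_mult:
  assumes "coprime a b" "a > 0" "b > 0"
  shows "hexideals (a * b) = hexideals a * hexideals b"
  unfolding hexideals_def sum_divisors_coprime_mult[OF assms(1)] sum_product
proof (intro sum.cong)
  fix i j assume "i \<in> {i. i dvd a}" "j \<in> {j. j dvd b}"
  then have ij: "i dvd a" "j dvd b" by auto
  then obtain a' b' where ab: "a = i * a'" "b = j * b'" by (metis dvdE)
  with assms have pos: "i > 0" "j > 0" "a' > 0" "b' > 0" by auto
  have cop: "coprime i j" "coprime a' b'" using assms(1) by (simp_all add: ab)
  have "a * b div (i * j) = a' * b'"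
    using pos by (simp add: ab mult.assoc mult.left_commute[of a' j])
  then show "(if is_square (i * j) then card (hexroots (a * b div (i * j))) else 0)
      = (if is_square i then card (hexroots (a div i)) else 0) * (if is_square j then card (hexroots (b div j)) else 0)"
    using pos cop by (simp add: ab card_hexroots_mult is_nth_power_mult_coprime_nat_iff)
qed simp_all

section \<open>Comparison with \<theta>\<close>

lemma sum_divisors_prime_power:
  fixes p :: nat and g :: "nat \<Rightarrow> 'a::comm_monoid_add"
  assumes "prime p"
  shows "(\<Sum>k | k dvd p ^ e. g k) = (\<Sum>i\<le>e. g (p ^ i))"
proof -
  have "{k. k dvd p ^ e} = (\<lambda>i. p ^ i) ` {..e}"
    using divides_primepow_nat[OF assms] by auto
  moreover have "inj_on (\<lambda>i. p ^ i) {..e}"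
    using prime_gt_1_nat[OF assms] by (auto simp: inj_on_def)
  ultimately show ?thesis by (simp add: sum.reindex)
qed

text \<open>Passing from \<open>e\<close> to \<open>e + 2\<close> adds
  \<open>r (e + 2) = c ^ (e + 1) + c ^ (e + 2)\<close> ideals, which are the two new terms of the
  divisor sum of the character. Hence the induction in steps of two.\<close>

lemma hexideals_prime_power:
  assumes "prime p" shows "int (hexideals (p ^ e)) = theta (p ^ e)"
proof -
  define c where "c = Legendre (int p) 3"
  define r where "r i = int (card (hexroots (p ^ i)))" for i
  have p: "p > 0" using assms by (rule prime_gt_0_nat)
  have r: "r 0 = 1" "r (Suc i) = c ^ i * (1 + c)" for i
    using card_hexroots_prime_power[OF assms, of i] by (simp_all add: r_def c_def)
  have "int (hexideals (p ^ e)) = (\<Sum>i\<le>e. if even i then r (e - i) else 0)"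
    unfolding hexideals_def sum_divisors_prime_power[OF assms] of_nat_sum
    by (intro sum.cong refl) (use assms p in \<open>auto simp: r_def is_nth_power_prime_power_nat_iff power_diff[symmetric]\<close>)
  also have "\<dots> = (\<Sum>i\<le>e. c ^ i)"
  proof (induction e rule: induct_nat_012)
    case (ge2 e)
    have "(\<Sum>i\<le>Suc (Suc e). if even i then r (Suc (Suc e) - i) else 0)
        = r (Suc (Suc e)) + (\<Sum>i\<le>e. if even i then r (e - i) else 0)"
      by (simp only: sum.atMost_Suc_shift) (simp cong: if_cong)
    also have "\<dots> = (\<Sum>i\<le>Suc (Suc e). c ^ i)"
      by (simp add: ge2 r algebra_simps)
    finally show ?case .
  qed (simp_all add: r)
  also have "\<dots> = theta (p ^ e)"
    by (simp only: theta_def sum_divisors_prime_power[OF assms] c_def Legendre_3_power)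
  finally show ?thesis .
qed

lemma hexideals_eq_theta:
  assumes "m > 0" shows "int (hexideals m) = theta m"
  using assms
proof (induction m rule: less_induct)
  case (less m)
  show ?case
  proof (cases "m = 1")
    case True
    then show ?thesis using hexideals_prime_power[of 2 0] by simp
  next
    case False
    then obtain p where p: "prime p" "p dvd m" using prime_factor_nat by blast
    obtain y where y: "m = p ^ multiplicity p m * y" "\<not> p dvd y"
      using multiplicity_decompose'[of m p] less.prems p(1) by (metis not_prime_unit bot_nat_0.not_eq_extremum)
    define e where "e = multiplicity p m"
    have "e > 0" using p less.prems unfolding e_def by (simp add: prime_multiplicity_gt_zero_iff)
    then have "p ^ e > 1" by (rule one_less_power[OF prime_gt_1_nat[OF p(1)]])
    moreover have "y > 0" using y(1) less.prems by (cases "y = 0") auto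
    ultimately have "y < m" using y(1) by (simp flip: e_def)
    moreover have cop: "coprime (p ^ e) y" using p(1) y(2) by (simp add: prime_imp_coprime)
    ultimately show ?thesis
      using less.IH[of y] hexideals_prime_power[OF p(1), of e] hexideals_mult[OF cop] theta_mult[OF cop]
        \<open>y > 0\<close> \<open>p ^ e > 1\<close> y(1) prime_gt_0_nat[OF p(1)] by (simp flip: e_def)
  qed
qed

section \<open>Invariant lattices\<close>

lemma zeta_pow_1_mult: "zeta_pow 1 * w = w + Eis 0 1 * w"
  by (cases w) simp

lemma zeta_pow_4_mult: "zeta_pow 4 * w = - (w + Eis 0 1 * w)"
  by (cases w) simp

lemma zeta_pow_5_mult: "zeta_pow 5 * w = - (Eis 0 1 * w)"
  by (cases w) simp

text \<open>\<omega> = \<zeta>^2 is a power of \<zeta>^k; conversely \<zeta>^k is 1 + \<omega> or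
  \<omega> up to sign.\<close>

lemma zeta_invariant_iff_omega:
  assumes L: "eis_additive L" and k: "\<not> 3 dvd k"
  shows "zeta_invariant k L \<longleftrightarrow> (\<forall>w\<in>L. Eis 0 1 * w \<in> L)"
proof -
  have "int k mod 6 = 1 \<or> int k mod 6 = 2 \<or> int k mod 6 = 4 \<or> int k mod 6 = 5"
    using k by presburger
  then consider "int k mod 6 = 1" | "int k mod 6 = 2" | "int k mod 6 = 4" | "int k mod 6 = 5" by blast
  note mod6 = this
  have imp: "Eis 0 1 * w \<in> L" if inv: "zeta_invariant k L" and w: "w \<in> L" for w
  proof -
    \<comment> \<open>Solvable since \<open>gcd k 6\<close> divides 2; the multipliers for the
      residues 1, 2, 4, 5 are 2, 1, 2, 4.\<close>
    obtain m where "(m * int k) mod 6 = 2"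
    proof (cases rule: mod6)
      case 1 then show ?thesis by (intro that[of 2]) presburger
    next
      case 2 then show ?thesis by (intro that[of 1]) simp
    next
      case 3 then show ?thesis by (intro that[of 2]) presburger
    next
      case 4 then show ?thesis by (intro that[of 4]) presburger
    qed
    then have "zeta_pow (m * int k) = zeta_pow 2" by (intro zeta_pow_cong) simp
    with zeta_invariant_pow[OF inv w, of m] show ?thesis by simp
  qed
  have inv: "zeta_invariant k L" if om: "\<And>w. w \<in> L \<Longrightarrow> Eis 0 1 * w \<in> L"
    unfolding zeta_invariant_def
  proof
    fix w assume w: "w \<in> L"
    note cl = om[OF w] w eis_additive_add[OF L] eis_additive_uminus[OF L]
    show "zeta_pow (int k) * w \<in> L"
    proof (cases rule: mod6)
      case 1
      then have "zeta_pow (int k) = zeta_pow 1" by (intro zeta_pow_cong) simp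
      then show ?thesis unfolding zeta_pow_1_mult by (simp only: zeta_pow_1_mult cl)
    next
      case 2
      then have "zeta_pow (int k) = Eis 0 1" using zeta_pow_cong[of "int k" 2] by simp
      then show ?thesis by (simp only: cl)
    next
      case 3
      then have "zeta_pow (int k) = zeta_pow 4" by (intro zeta_pow_cong) simp
      then show ?thesis by (simp only: zeta_pow_4_mult cl)
    next
      case 4
      then have "zeta_pow (int k) = zeta_pow 5" by (intro zeta_pow_cong) simp
      then show ?thesis by (simp only: zeta_pow_5_mult cl)
    qed
  qed
  show ?thesis using imp inv by blast
qed

lemma zeta_pow_3_dvd:
  assumes "3 dvd c" shows "zeta_pow c = 1 \<or> zeta_pow c = - 1"
proof -
  have "c mod 6 = 0 \<or> c mod 6 = 3" using assms by presburger
  then show ?thesis using zeta_pow_cong[of c 0] zeta_pow_cong[of c 3] by auto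
qed

lemma zeta_invariant_3_dvd:
  assumes "eis_additive L" "3 dvd k" shows "zeta_invariant k L"
proof -
  have "3 dvd int k" using assms(2) by presburger
  with zeta_pow_3_dvd[of "int k"] eis_additive_uminus[OF assms(1)] show ?thesis
    by (auto simp: zeta_invariant_def)
qed

lemma lat_combination:
  "Eis (int a * s + int b * t) (int d * t)
    = of_int s * Eis (int a) 0 + of_int t * Eis (int b) (int d)"
  by (simp add: of_int_eis mult.commute)

lemma lat_invariant_iff:
  assumes "d > 0"
  shows "(\<forall>w\<in>lat a b d. c * w \<in> lat a b d) \<longleftrightarrow>
    c * Eis (int a) 0 \<in> lat a b d \<and> c * Eis (int b) (int d) \<in> lat a b d"
proof
  assume gen: "c * Eis (int a) 0 \<in> lat a b d \<and> c * Eis (int b) (int d) \<in> lat a b d"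
  note L = eis_additive_lat[OF assms, of a b]
  show "\<forall>w\<in>lat a b d. c * w \<in> lat a b d"
  proof
    fix w assume "w \<in> lat a b d"
    then obtain s t where w: "w = of_int s * Eis (int a) 0 + of_int t * Eis (int b) (int d)"
      using mem_lat[OF assms] lat_combination by metis
    have "c * w = of_int s * (c * Eis (int a) 0) + of_int t * (c * Eis (int b) (int d))"
      unfolding w by (simp only: distrib_left mult.left_commute)
    then show "c * w \<in> lat a b d"
      using gen by (simp only: eis_additive_add[OF L] eis_additive_of_int[OF L])
  qed
next
  assume "\<forall>w\<in>lat a b d. c * w \<in> lat a b d"
  moreover have "Eis (int a) 0 \<in> lat a b d" by simp
  moreover have "Eis (int b) (int d) \<in> lat a b d" using assms by (simp add: Eis_mem_lat_basis)
  ultimately show "c * Eis (int a) 0 \<in> lat a b d \<and> c * Eis (int b) (int d) \<in> lat a b d" by blast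
qed

text \<open>The second coordinates of the basis vectors multiplied by \<omega> are \<open>a\<close>
  and \<open>b - d\<close>, and every second coordinate in the lattice is a multiple of
  \<open>d\<close>.\<close>

lemma omega_invariant_lat_imp_dvd:
  assumes "d > 0" "\<forall>w\<in>lat a b d. Eis 0 1 * w \<in> lat a b d"
  shows "d dvd a" "d dvd b"
proof -
  have "Eis 0 (int a) \<in> lat a b d" "Eis (- int d) (int b - int d) \<in> lat a b d"
    using assms lat_invariant_iff[OF assms(1)] by simp_all
  then have "int d dvd int a" "int d dvd int b - int d" by (simp_all add: lat_def)
  then show "d dvd a" "d dvd b" by (simp_all add: dvd_diff_left_iff)
qed

text \<open>After division by \<open>d\<close>, \<omega> (t + \<omega>) - (t - 1) (t + \<omega>) = -
  (t^2 - t + 1) must be a multiple of \<open>a\<close>; the product \<omega> a always lies in the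
  lattice.\<close>

lemma omega_invariant_lat_scaled:
  assumes "d > 0"
  shows "(\<forall>w\<in>lat (d * a) (d * t) d. Eis 0 1 * w \<in> lat (d * a) (d * t) d)
    \<longleftrightarrow> int a dvd int t ^ 2 - int t + 1"
proof -
  have div: "(int d * int t - int d) div int d = int t - 1"
  proof -
    have "int d * int t - int d = int d * (int t - 1)" by (simp add: algebra_simps)
    then show ?thesis using assms by simp
  qed
  have "(\<forall>w\<in>lat (d * a) (d * t) d. Eis 0 1 * w \<in> lat (d * a) (d * t) d)
    \<longleftrightarrow> int (d * a) dvd - int d - int (d * t) * (int t - 1)"
    unfolding lat_invariant_iff[OF assms] using assms by (simp add: lat_def div)
  also have "- int d - int (d * t) * (int t - 1) = - (int d * (int t ^ 2 - int t + 1))"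
    by (simp add: power2_eq_square algebra_simps)
  also have "int (d * a) dvd - (int d * (int t ^ 2 - int t + 1)) \<longleftrightarrow> int a dvd int t ^ 2 - int t + 1"
    using assms by simp
  finally show ?thesis .
qed

text \<open>For positive \<open>m\<close>, \<open>lat_eq_imp\<close> shows that distinct triples
  give distinct lattices; counting triples makes finiteness plain.\<close>

definition hnf_lattices :: "nat \<Rightarrow> nat \<Rightarrow> (nat \<times> nat \<times> nat) set"
  where "hnf_lattices k m = {(a, b, d). a * d = m \<and> b < a \<and> zeta_invariant k (lat a b d)}"

lemma finite_hnf_lattices:
  assumes "m > 0" shows "finite (hnf_lattices k m)"
proof (rule finite_subset)
  show "hnf_lattices k m \<subseteq> {..m} \<times> {..m} \<times> {..m}"
  proof
    fix x assume "x \<in> hnf_lattices k m"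
    then obtain a b d where x: "x = (a, b, d)" "a * d = m" "b < a" by (auto simp: hnf_lattices_def)
    then have "a dvd m" "d dvd m" by auto
    with assms have "a \<le> m" "d \<le> m" by (auto dest: dvd_imp_le)
    with x show "x \<in> {..m} \<times> {..m} \<times> {..m}" by auto
  qed
qed simp

text \<open>Invariance is automatic, so \<open>a\<close> runs over the divisors of \<open>m\<close>
  and \<open>b\<close> freely below \<open>a\<close>.\<close>

lemma card_hnf_lattices_3_dvd:
  assumes "m > 0" "3 dvd k" shows "card (hnf_lattices k m) = sigma1 m"
proof -
  have "bij_betw (\<lambda>(a, b). (a, b, m div a)) (SIGMA a:{a. a dvd m}. {..<a}) (hnf_lattices k m)"
    using assms
    by (intro bij_betw_byWitness[where f' = "\<lambda>(a, b, d). (a, b)"])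
      (auto simp: hnf_lattices_def intro!: zeta_invariant_3_dvd eis_additive_lat elim!: dvdE)
  then have "card (hnf_lattices k m) = card (SIGMA a:{a. a dvd m}. {..<a})"
    by (rule bij_betw_same_card[symmetric])
  also have "\<dots> = sigma1 m"
    using assms(1) by (simp add: sigma1_def card_SigmaI)
  finally show ?thesis .
qed

text \<open>Since \<open>d\<close> divides \<open>a\<close> and \<open>b\<close>, an ideal is
  \<open>e = d\<close> times the lattice spanned by \<open>m div e ^ 2\<close> and t + \<omega>,
  where \<open>t\<close> is a root modulo \<open>m div e ^ 2\<close>.\<close>

lemma card_hnf_lattices_not_3_dvd:
  assumes m: "m > 0" and k: "\<not> 3 dvd k" shows "int (card (hnf_lattices k m)) = theta m"
proof -
  let ?E = "{e. e ^ 2 dvd m}"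
  have fin: "finite ?E"
  proof (rule finite_subset)
    show "?E \<subseteq> {e. e dvd m}" by (auto simp: power2_eq_square dest: dvd_mult_left)
  qed (use m in simp)
  have "bij_betw (\<lambda>(e, t). (e * (m div e ^ 2), e * t, e)) (SIGMA e:?E. hexroots (m div e ^ 2)) (hnf_lattices k m)"
  proof (intro bij_betw_byWitness[where f' = "\<lambda>(a, b, d). (d, b div d)"] ballI subsetI)
    fix x assume "x \<in> (SIGMA e:?E. hexroots (m div e ^ 2))"
    then obtain e t where x: "x = (e, t)" "e ^ 2 dvd m" "t \<in> hexroots (m div e ^ 2)" by auto
    with m have e: "e > 0" by (cases "e = 0") auto
    then show "(case (case x of (e, t) \<Rightarrow> (e * (m div e ^ 2), e * t, e)) of (a, b, d) \<Rightarrow> (d, b div d)) = x"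
      by (simp add: x)
  next
    fix y assume "y \<in> (\<lambda>(e, t). (e * (m div e ^ 2), e * t, e)) ` (SIGMA e:?E. hexroots (m div e ^ 2))"
    then obtain e t where y: "y = (e * (m div e ^ 2), e * t, e)" "e ^ 2 dvd m" "t \<in> hexroots (m div e ^ 2)" by auto
    with m have e: "e > 0" by (cases "e = 0") auto
    have "e * (m div e ^ 2) * e = m"
      using y(2) by (metis dvd_mult_div_cancel mult.assoc mult.commute power2_eq_square)
    moreover have "zeta_invariant k (lat (e * (m div e ^ 2)) (e * t) e)"
      using y(3) unfolding zeta_invariant_iff_omega[OF eis_additive_lat[OF e] k] omega_invariant_lat_scaled[OF e]
      by (simp add: hexroots_def)
    ultimately show "y \<in> hnf_lattices k m"
      using y(3) e by (simp add: y(1) hnf_lattices_def hexroots_def)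
  next
    fix y assume "y \<in> hnf_lattices k m"
    then obtain a b d where y: "y = (a, b, d)" "a * d = m" "b < a" "zeta_invariant k (lat a b d)"
      by (auto simp: hnf_lattices_def)
    with m have d: "d > 0" by (cases "d = 0") auto
    have inv: "\<forall>w\<in>lat a b d. Eis 0 1 * w \<in> lat a b d"
      using y(4) zeta_invariant_iff_omega[OF eis_additive_lat[OF d] k] by simp
    from omega_invariant_lat_imp_dvd[OF d this] obtain a' t where ab: "a = d * a'" "b = d * t"
      by (metis dvdE)
    from inv have "int a' dvd int t ^ 2 - int t + 1"
      unfolding ab omega_invariant_lat_scaled[OF d] .
    moreover have m': "m = d ^ 2 * a'" using y(2) by (simp add: ab power2_eq_square mult_ac)
    moreover have "m div d ^ 2 = a'" using d by (simp add: m')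
    moreover have "t < a'" using y(3) d by (simp add: ab)
    ultimately have mem: "(d, t) \<in> (SIGMA e:?E. hexroots (m div e ^ 2))"
      by (simp add: hexroots_def)
    have wit: "(case y of (a, b, d) \<Rightarrow> (d, b div d)) = (d, t)"
      using d by (simp add: y(1) ab)
    show "(case (case y of (a, b, d) \<Rightarrow> (d, b div d)) of (e, t) \<Rightarrow> (e * (m div e ^ 2), e * t, e)) = y"
      unfolding wit using \<open>m div d ^ 2 = a'\<close> by (simp add: y(1) ab)
  next
    fix x assume "x \<in> (\<lambda>(a, b, d). (d, b div d)) ` hnf_lattices k m"
    then obtain y where y': "y \<in> hnf_lattices k m" "x = (case y of (a, b, d) \<Rightarrow> (d, b div d))" by blast
    then obtain a b d where y: "y = (a, b, d)" "a * d = m" "b < a" "zeta_invariant k (lat a b d)"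
      by (auto simp: hnf_lattices_def)
    with m have d: "d > 0" by (cases "d = 0") auto
    have inv: "\<forall>w\<in>lat a b d. Eis 0 1 * w \<in> lat a b d"
      using y(4) zeta_invariant_iff_omega[OF eis_additive_lat[OF d] k] by simp
    from omega_invariant_lat_imp_dvd[OF d this] obtain a' t where ab: "a = d * a'" "b = d * t"
      by (metis dvdE)
    from inv have "int a' dvd int t ^ 2 - int t + 1"
      unfolding ab omega_invariant_lat_scaled[OF d] .
    moreover have m': "m = d ^ 2 * a'" using y(2) by (simp add: ab power2_eq_square mult_ac)
    moreover have "m div d ^ 2 = a'" using d by (simp add: m')
    moreover have "t < a'" using y(3) d by (simp add: ab)
    ultimately show "x \<in> (SIGMA e:?E. hexroots (m div e ^ 2))"
      using d by (simp add: y' y(1) ab hexroots_def)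
  qed
  then have "card (hnf_lattices k m) = card (SIGMA e:?E. hexroots (m div e ^ 2))"
    by (rule bij_betw_same_card[symmetric])
  also have "\<dots> = (\<Sum>e\<in>?E. card (hexroots (m div e ^ 2)))"
    using fin by (simp add: card_SigmaI)
  also have "\<dots> = (\<Sum>j\<in>(\<lambda>e. e ^ 2) ` ?E. card (hexroots (m div j)))"
    by (subst sum.reindex) (auto simp: inj_on_def)
  also have "\<dots> = (\<Sum>j | j dvd m. if is_square j then card (hexroots (m div j)) else 0)"
    using m by (intro sum.mono_neutral_cong_left) (auto simp: is_nth_power_def)
  also have "\<dots> = hexideals m" by (simp add: hexideals_def)
  finally show ?thesis using hexideals_eq_theta[OF m] by simp
qed

section \<open>Isomorphism types of the subgroups\<close>

definition eis_norm :: "eis \<Rightarrow> int"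
  where "eis_norm w = eis_re w ^ 2 - eis_re w * eis_om w + eis_om w ^ 2"

text \<open>Complex conjugation, which sends \<omega> to - 1 - \<omega>.\<close>

definition eis_cnj :: "eis \<Rightarrow> eis"
  where "eis_cnj w = Eis (eis_re w - eis_om w) (- eis_om w)"

lemma eis_norm_mult: "eis_norm (v * w) = eis_norm v * eis_norm w"
  by (cases v; cases w) (simp add: eis_norm_def power2_eq_square algebra_simps)

lemma eis_norm_cnj: "eis_norm (eis_cnj w) = eis_norm w"
  by (cases w) (simp add: eis_norm_def eis_cnj_def power2_eq_square algebra_simps)

lemma mult_eis_cnj: "w * eis_cnj w = of_int (eis_norm w)"
  by (cases w) (simp add: eis_norm_def eis_cnj_def of_int_eis power2_eq_square algebra_simps)

lemma eis_norm_4: "4 * eis_norm w = (2 * eis_re w - eis_om w) ^ 2 + 3 * eis_om w ^ 2"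
  by (simp add: eis_norm_def power2_eq_square algebra_simps)

lemma eis_norm_nonneg: "eis_norm w \<ge> 0"
  using eis_norm_4[of w] zero_le_power2[of "2 * eis_re w - eis_om w"] zero_le_power2[of "eis_om w"]
  by linarith

lemma eis_norm_eq_0_iff: "eis_norm w = 0 \<longleftrightarrow> w = 0"
proof
  assume "eis_norm w = 0"
  then have "(2 * eis_re w - eis_om w) ^ 2 = 0 \<and> eis_om w ^ 2 = 0"
    using eis_norm_4[of w] zero_le_power2[of "2 * eis_re w - eis_om w"] zero_le_power2[of "eis_om w"]
    by linarith
  then show "w = 0" by (cases w) simp
qed (simp add: eis_norm_def zero_eis_def)

lemma int_round:
  fixes s n :: int assumes "n > 0" shows "\<exists>q. \<bar>2 * (s - n * q)\<bar> \<le> n"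
proof
  let ?q = "(2 * s + n) div (2 * n)"
  have "2 * n * ?q + (2 * s + n) mod (2 * n) = 2 * s + n" by (rule mult_div_mod_eq)
  moreover have "0 \<le> (2 * s + n) mod (2 * n)" "(2 * s + n) mod (2 * n) < 2 * n" using assms by simp_all
  ultimately show "\<bar>2 * (s - n * ?q)\<bar> \<le> n" by (simp add: right_diff_distrib mult.assoc)
qed

text \<open>The coordinates of the quotient \<open>w * eis_cnj a / n\<close> are rounded to nearest
  integers. The errors are at most 1/2, so the norm of the remainder is at most 3/4 of that of
  \<open>a\<close>.\<close>

lemma eis_division:
  assumes "a \<noteq> 0" shows "\<exists>q. eis_norm (w - q * a) < eis_norm a"
proof -
  define n where "n = eis_norm a"
  have n: "n > 0" using assms eis_norm_nonneg[of a] eis_norm_eq_0_iff[of a] by (simp add: n_def)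
  obtain s t where st: "w * eis_cnj a = Eis s t" by (metis eis.exhaust)
  obtain q1 q2 where q: "\<bar>2 * (s - n * q1)\<bar> \<le> n" "\<bar>2 * (t - n * q2)\<bar> \<le> n"
    using int_round[OF n] by metis
  define x y where "x = s - n * q1" and "y = t - n * q2"
  have "(w - Eis q1 q2 * a) * eis_cnj a = Eis s t - Eis q1 q2 * of_int n"
    by (simp only: left_diff_distrib mult.assoc mult_eis_cnj st n_def)
  also have "\<dots> = Eis x y" by (simp add: of_int_eis x_def y_def mult.commute)
  finally have "eis_norm (w - Eis q1 q2 * a) * n = eis_norm (Eis x y)"
    by (metis eis_norm_mult eis_norm_cnj n_def)
  moreover have "4 * eis_norm (Eis x y) \<le> 3 * (n * n)"
  proof -
    have xy: "\<bar>2 * x\<bar> \<le> n" "\<bar>2 * y\<bar> \<le> n" using q by (simp_all add: x_def y_def)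
    have "\<bar>2 * x\<bar> * \<bar>2 * x\<bar> \<le> n * n" "\<bar>2 * y\<bar> * \<bar>2 * y\<bar> \<le> n * n" "\<bar>2 * x\<bar> * \<bar>2 * y\<bar> \<le> n * n"
      by (intro mult_mono xy abs_ge_zero less_imp_le[OF n])+
    then have "(2 * x) * (2 * x) \<le> n * n" "(2 * y) * (2 * y) \<le> n * n" "- ((2 * x) * (2 * y)) \<le> n * n"
      by (simp_all add: abs_mult[symmetric] abs_le_iff)
    then show ?thesis by (simp add: eis_norm_def power2_eq_square)
  qed
  ultimately have "4 * (eis_norm (w - Eis q1 q2 * a) * n) \<le> 3 * (n * n)" by simp
  also have "\<dots> < 4 * (n * n)" using n by simp
  finally have "eis_norm (w - Eis q1 q2 * a) * n < n * n" by simp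
  then have "eis_norm (w - Eis q1 q2 * a) < n" using n by (simp add: mult_less_cancel_right)
  then show ?thesis unfolding n_def by blast
qed

text \<open>A nonzero element of least norm generates, by division with remainder.\<close>

lemma omega_invariant_principal:
  assumes L: "eis_additive L" and om: "\<And>w. w \<in> L \<Longrightarrow> Eis 0 1 * w \<in> L" and "v \<in> L" "v \<noteq> 0"
  shows "\<exists>a. a \<noteq> 0 \<and> L = range (\<lambda>w. w * a)"
proof -
  have ideal: "c * w \<in> L" if "w \<in> L" for c w
  proof -
    have "c = of_int (eis_re c) + of_int (eis_om c) * Eis 0 1"
      by (cases c) (simp add: of_int_eis)
    then have "c * w = of_int (eis_re c) * w + of_int (eis_om c) * (Eis 0 1 * w)"
      by (metis distrib_right mult.assoc)
    then show ?thesis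
      using that om by (simp only: eis_additive_add[OF L] eis_additive_of_int[OF L])
  qed
  have "\<exists>a. (a \<in> L \<and> a \<noteq> 0) \<and> (\<forall>b. b \<in> L \<and> b \<noteq> 0 \<longrightarrow> nat (eis_norm a) \<le> nat (eis_norm b))"
    using assms(3,4) by (intro ex_has_least_nat[of _ v]) simp
  then obtain a where a: "a \<in> L" "a \<noteq> 0" and min: "\<And>b. b \<in> L \<Longrightarrow> b \<noteq> 0 \<Longrightarrow> nat (eis_norm a) \<le> nat (eis_norm b)"
    by blast
  have "w \<in> range (\<lambda>w. w * a)" if "w \<in> L" for w
  proof -
    obtain q where q: "eis_norm (w - q * a) < eis_norm a" using eis_division[OF a(2)] by blast
    have "w - q * a \<in> L" using that ideal[OF a(1)] by (intro eis_additive_diff[OF L])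
    with q min[of "w - q * a"] eis_norm_nonneg[of "w - q * a"] have "w - q * a = 0"
      by (cases "w - q * a = 0") (simp_all add: nat_le_eq_zle)
    then show ?thesis by simp
  qed
  with ideal[OF a(1)] a(2) show ?thesis by blast
qed

lemma eis_mult_right_cancel: "a \<noteq> 0 \<Longrightarrow> v * a = w * a \<longleftrightarrow> v = (w::eis)"
proof
  assume "a \<noteq> 0" "v * a = w * a"
  then have "eis_norm (v - w) * eis_norm a = 0"
    by (simp flip: eis_norm_mult add: left_diff_distrib eis_norm_eq_0_iff)
  with \<open>a \<noteq> 0\<close> show "v = w" by (simp add: eis_norm_eq_0_iff)
qed simp

text \<open>The map is \<open>f\<close> on the lattice, and the cyclic generator goes to the screw
  or, for \<open>e = - 1\<close>, to its inverse; the sign is what lets \<open>k\<close> and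
  \<open>j\<close> agree modulo 6.\<close>

lemma screw_subgroup_iso:
  assumes k: "k > 0" and e: "e = 1 \<or> e = - 1" "(e * int k) mod 6 = j mod 6"
    and add: "\<And>v w. f (v + w) = f v + f w" and inj: "inj f" and range: "range f = L"
    and comm: "\<And>c w. f (zeta_pow (j * c) * w) = zeta_pow (j * c) * f w"
  shows "eis_group j \<cong> eis_group 1\<lparr>carrier := screw_subgroup k L v\<rparr>"
proof -
  define h where "h p = (f (fst p) + screw_shift k v (e * snd p), e * snd p * int k)" for p
  have zeta: "zeta_pow (e * c * int k) = zeta_pow (j * c)" for c
  proof (rule zeta_pow_cong)
    have "e * c * int k mod 6 = (e * int k) mod 6 * c mod 6"
      by (metis mod_mult_left_eq mult.assoc mult.commute)
    also have "\<dots> = j * c mod 6" by (simp only: e(2) mod_mult_left_eq)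
    finally show "e * c * int k mod 6 = j * c mod 6" .
  qed
  have mult: "h (p \<otimes>\<^bsub>eis_group j\<^esub> q) = h p \<otimes>\<^bsub>eis_group 1\<^esub> h q" for p q
  proof -
    obtain w c w' c' where pq: "p = (w, c)" "q = (w', c')" by fastforce
    show ?thesis
      by (simp add: pq h_def add comm distrib_left distrib_right screw_shift_add zeta add.assoc)
  qed
  have mem: "h p \<in> screw_subgroup k L v" for p
    unfolding h_def by (rule screw_subgroupI) (use range in auto)
  have "h \<in> hom (eis_group j) (eis_group 1\<lparr>carrier := screw_subgroup k L v\<rparr>)"
    by (rule homI) (simp_all only: mult, simp_all add: mem)
  moreover have "bij_betw h (carrier (eis_group j)) (carrier (eis_group 1\<lparr>carrier := screw_subgroup k L v\<rparr>))"
  proof (rule bij_betwI')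
    fix p q show "(h p = h q) = (p = q)"
    proof
      assume eq: "h p = h q"
      have "e * snd p * int k = e * snd q * int k" using eq unfolding h_def prod.inject by blast
      with k e(1) have snd: "snd p = snd q" by auto
      have "f (fst p) + screw_shift k v (e * snd p) = f (fst q) + screw_shift k v (e * snd q)"
        using eq unfolding h_def prod.inject by blast
      then have "f (fst p) = f (fst q)" unfolding snd by (simp only: add_right_cancel)
      with inj have "fst p = fst q" by (rule injD)
      with snd show "p = q" by (rule prod_eqI[rotated])
    qed simp
    show "h p \<in> carrier (eis_group 1\<lparr>carrier := screw_subgroup k L v\<rparr>)" by (simp add: mem)
  next
    fix y assume "y \<in> carrier (eis_group 1\<lparr>carrier := screw_subgroup k L v\<rparr>)"
    then obtain w m where y: "y = (w, m * int k)" "w - screw_shift k v m \<in> L"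
      by (auto simp: screw_subgroup_def)
    then obtain u where u: "w - screw_shift k v m = f u" using range by blast
    have em: "e * (e * m) = m" using e(1) by auto
    have "y = h (u, e * m)" unfolding h_def fst_conv snd_conv em y(1) u[symmetric] by simp
    then show "\<exists>p\<in>carrier (eis_group j). y = h p" by (rule bexI) simp
  qed
  ultimately show ?thesis by (intro is_isoI isoI)
qed

section \<open>Reduction of the screw step modulo 6\<close>

lemma gcd_6_eq: "gcd k 6 = (if 6 dvd k then 6 else if 3 dvd k then 3 else if 2 dvd k then 2 else (1::nat))"
proof -
  define g where "g = gcd k 6"
  have dvd: "m dvd g \<longleftrightarrow> m dvd k" if "m dvd 6" for m using that by (simp add: g_def)
  have "g dvd 6" by (simp add: g_def)
  then have "0 < g" "g \<le> 6" by (auto simp: g_def dest: dvd_imp_le)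
  then have "g = 1 \<or> g = 2 \<or> g = 3 \<or> g = 4 \<or> g = 5 \<or> g = 6" by linarith
  then have g: "g = 1 \<or> g = 2 \<or> g = 3 \<or> g = 6" using \<open>g dvd 6\<close> by (elim disjE) simp_all
  have "2 dvd g \<longleftrightarrow> 2 dvd k" "3 dvd g \<longleftrightarrow> 3 dvd k" "6 dvd g \<longleftrightarrow> 6 dvd k" by (simp_all add: dvd)
  with g show ?thesis unfolding g_def[symmetric] by (elim disjE) simp_all
qed

text \<open>The sign is negative exactly for the residues 4 and 5, which are - 2 and - 1 modulo
  6.\<close>

lemma gcd_6_sign: "\<exists>e. (e = 1 \<or> e = - 1) \<and> (e * int k) mod 6 = int (gcd k 6) mod 6"
proof -
  have d6: "6 dvd k \<longleftrightarrow> k mod 6 = 0" "3 dvd k \<longleftrightarrow> k mod 6 = 0 \<or> k mod 6 = 3"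
    "2 dvd k \<longleftrightarrow> k mod 6 = 0 \<or> k mod 6 = 2 \<or> k mod 6 = 4"
    by presburger+
  have neg: "(- int k) mod 6 = 2" if "k mod 6 = 4" using that by presburger
  have neg': "(- int k) mod 6 = 1" if "k mod 6 = 5" using that by presburger
  have int: "int k mod 6 = int (k mod 6)" by (simp add: of_nat_mod)
  have "k mod 6 = 0 \<or> k mod 6 = 1 \<or> k mod 6 = 2 \<or> k mod 6 = 3 \<or> k mod 6 = 4 \<or> k mod 6 = 5"
    by presburger
  then show ?thesis unfolding gcd_6_eq d6
    by (elim disjE) (rule exI[of _ "if k mod 6 \<le> 3 then 1 else - 1"], simp add: int neg neg')+
qed

text \<open>If 3 divides \<open>k\<close>, all acting powers of \<zeta> are signs, with which the
  coordinate map of the basis commutes. Otherwise the lattice is a principal ideal, and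
  multiplication by a generator commutes with everything.\<close>

lemma screw_subgroup_lat_iso:
  assumes k: "k > 0" and ad: "a > 0" "d > 0" and inv: "zeta_invariant k (lat a b d)"
  shows "eis_group (int (gcd k 6)) \<cong> eis_group 1\<lparr>carrier := screw_subgroup k (lat a b d) v\<rparr>"
proof -
  obtain e where e: "e = 1 \<or> e = - 1" "(e * int k) mod 6 = int (gcd k 6) mod 6"
    using gcd_6_sign by blast
  note L = eis_additive_lat[OF ad(2), of a b]
  show ?thesis
  proof (cases "3 dvd k")
    case True
    define f where "f w = Eis (int a * eis_re w + int b * eis_om w) (int d * eis_om w)" for w
    have "f (v + w) = f v + f w" for v w
      by (cases v; cases w) (simp add: f_def algebra_simps)
    moreover have "inj f"
    proof (rule injI)
      fix v w assume "f v = f w" then show "v = w"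
        using ad by (cases v; cases w) (simp add: f_def)
    qed
    moreover have "range f = lat a b d"
    proof (intro equalityI subsetI)
      fix w assume "w \<in> range f" then show "w \<in> lat a b d"
        unfolding mem_lat[OF ad(2)] f_def by blast
    next
      fix w assume "w \<in> lat a b d"
      then obtain s t where "w = Eis (int a * s + int b * t) (int d * t)"
        unfolding mem_lat[OF ad(2)] by blast
      then have "w = f (Eis s t)" by (simp add: f_def)
      then show "w \<in> range f" by blast
    qed
    moreover have "f (zeta_pow (int (gcd k 6) * c) * w) = zeta_pow (int (gcd k 6) * c) * f w" for c w
    proof -
      have "3 dvd gcd k 6" using True by simp
      then have "(3::int) dvd int (gcd k 6)" by presburger
      then have "3 dvd int (gcd k 6) * c" by (rule dvd_mult2)
      then have "zeta_pow (int (gcd k 6) * c) = 1 \<or> zeta_pow (int (gcd k 6) * c) = - 1"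
        by (rule zeta_pow_3_dvd)
      moreover have "f (- w) = - f w" by (cases w) (simp add: f_def)
      ultimately show ?thesis by auto
    qed
    ultimately show ?thesis using k e by (intro screw_subgroup_iso[of k e _ f])
  next
    case False
    have "Eis (int a) 0 \<in> lat a b d" "Eis (int a) 0 \<noteq> 0" using ad by simp_all
    with False inv obtain a' where a': "a' \<noteq> 0" "lat a b d = range (\<lambda>w. w * a')"
      using omega_invariant_principal[OF L] zeta_invariant_iff_omega[OF L] by blast
    then show ?thesis
      using k e by (intro screw_subgroup_iso[of k e _ "\<lambda>w. w * a'"])
        (auto simp: distrib_right mult.assoc eis_mult_right_cancel intro: injI)
  qed
qed

section \<open>Parametrisation of the subgroups\<close>

text \<open>Entries are the screw step, the normal form and a point of its box. The set
  \<open>K\<close> restricts the step, so that all subgroups and those of one type are covered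
  alike.\<close>

definition subgroup_params :: "nat set \<Rightarrow> nat \<Rightarrow> (nat \<times> (nat \<times> nat \<times> nat) \<times> nat \<times> nat) set"
  where "subgroup_params K n = (SIGMA k:{k \<in> K. k dvd n}.
    SIGMA l:hnf_lattices k (n div k). {..<fst l} \<times> {..<snd (snd l)})"

definition param_subgroup :: "nat \<times> (nat \<times> nat \<times> nat) \<times> nat \<times> nat \<Rightarrow> (eis \<times> int) set"
  where "param_subgroup = (\<lambda>(k, (a, b, d), (p, q)). screw_subgroup k (lat a b d) (Eis (int p) (int q)))"

lemma subgroup_params_iff:
  assumes "n > 0"
  shows "(k, (a, b, d), (p, q)) \<in> subgroup_params K n \<longleftrightarrow> k \<in> K \<and> k > 0 \<and> a > 0 \<and> d > 0 \<and> b < a \<and> p < a \<and> q < d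
    \<and> zeta_invariant k (lat a b d) \<and> k * (a * d) = n"
proof -
  have "a * d = n div k \<longleftrightarrow> k * (a * d) = n" if "k dvd n"
    using that assms by (auto elim!: dvdE)
  moreover have "k dvd n" if "k * (a * d) = n" using that by auto
  ultimately show ?thesis
    using assms by (auto simp: subgroup_params_def hnf_lattices_def)
qed

lemma finite_subgroup_params:
  assumes "n > 0" shows "finite (subgroup_params K n)"
proof -
  have "finite (hnf_lattices k (n div k))" if "k dvd n" for k
    using that assms by (intro finite_hnf_lattices) (auto elim!: dvdE)
  then show ?thesis
    unfolding subgroup_params_def using assms by (intro finite_SigmaI) auto
qed

lemma card_subgroup_params:
  assumes "n > 0"
  shows "card (subgroup_params K n) = (\<Sum>k | n div k \<in> K \<and> k dvd n. k * card (hnf_lattices (n div k) k))"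
proof -
  have pos: "n div k > 0" if "k dvd n" for k
    using that assms by (auto elim!: dvdE)
  have fib: "card (SIGMA l:hnf_lattices k (n div k). {..<fst l} \<times> {..<snd (snd l)})
      = n div k * card (hnf_lattices k (n div k))" if "k dvd n" for k
  proof -
    have "card (SIGMA l:hnf_lattices k (n div k). {..<fst l} \<times> {..<snd (snd l)})
        = (\<Sum>l\<in>hnf_lattices k (n div k). fst l * snd (snd l))"
      using finite_hnf_lattices[OF pos[OF that]] by (simp add: card_SigmaI card_cartesian_product)
    also have "\<dots> = (\<Sum>l\<in>hnf_lattices k (n div k). n div k)"
      by (intro sum.cong) (auto simp: hnf_lattices_def)
    finally show ?thesis by simp
  qed
  have "card (subgroup_params K n) = (\<Sum>k\<in>{k \<in> K. k dvd n}.
      card (SIGMA l:hnf_lattices k (n div k). {..<fst l} \<times> {..<snd (snd l)}))"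
    unfolding subgroup_params_def using assms finite_hnf_lattices pos
    by (intro card_SigmaI) auto
  also have "\<dots> = (\<Sum>k\<in>{k \<in> K. k dvd n}. n div k * card (hnf_lattices k (n div k)))"
    by (intro sum.cong fib) simp_all
  \<comment> \<open>The substitution \<open>k \<mapsto> n div k\<close> makes the lattice index the
    summation variable.\<close>
  also have "\<dots> = (\<Sum>k | n div k \<in> K \<and> k dvd n. k * card (hnf_lattices (n div k) k))"
    by (rule sum.reindex_bij_witness[where i = "\<lambda>k. n div k" and j = "\<lambda>k. n div k"])
      (use assms in \<open>auto elim!: dvdE\<close>)
  finally show ?thesis .
qed

lemma bij_betw_param_subgroup:
  assumes n: "n > 0"
  shows "bij_betw param_subgroup (subgroup_params UNIV n) (subgroups_of_index (eis_group 1) n)"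
proof (rule bij_betwI')
  fix x y assume "x \<in> subgroup_params UNIV n" "y \<in> subgroup_params UNIV n"
  moreover obtain k a b d p q k' a' b' d' p' q'
    where "x = (k, (a, b, d), (p, q))" "y = (k', (a', b', d'), (p', q'))"
    by (metis prod.collapse)
  ultimately show "(param_subgroup x = param_subgroup y) = (x = y)"
    using screw_subgroup_eq_imp[of k a b d p q k' a' b' d' p' q']
    by (auto simp: subgroup_params_iff[OF n] param_subgroup_def)
next
  fix x assume x: "x \<in> subgroup_params UNIV n"
  moreover obtain k a b d p q where "x = (k, (a, b, d), (p, q))" by (metis prod.collapse)
  ultimately show "param_subgroup x \<in> subgroups_of_index (eis_group 1) n"
    by (simp add: subgroup_params_iff[OF n] param_subgroup_def subgroups_of_index_def
        subgroup_screw_subgroup eis_additive_lat screw_subgroup_index)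
next
  fix D assume "D \<in> subgroups_of_index (eis_group 1) n"
  then have D: "subgroup D (eis_group 1)" "card (rcosets\<^bsub>eis_group 1\<^esub> D) = n"
    by (simp_all add: subgroups_of_index_def)
  then have "finite (rcosets\<^bsub>eis_group 1\<^esub> D)" using n by (metis card.infinite less_irrefl)
  from finite_index_screw_subgroup[OF D(1) this] obtain k a b d p q
    where p: "k > 0" "a > 0" "d > 0" "b < a" "p < a" "q < d" "zeta_invariant k (lat a b d)"
      "D = screw_subgroup k (lat a b d) (Eis (int p) (int q))" by blast
  with D(2) have "k * (a * d) = n" by (simp add: screw_subgroup_index)
  with p have "(k, (a, b, d), (p, q)) \<in> subgroup_params UNIV n"
    by (simp add: subgroup_params_iff[OF n])
  moreover have "D = param_subgroup (k, (a, b, d), (p, q))" by (simp add: param_subgroup_def p)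
  ultimately show "\<exists>x\<in>subgroup_params UNIV n. D = param_subgroup x" by blast
qed

lemma param_subgroup_iso:
  assumes "n > 0" "(k, l) \<in> subgroup_params UNIV n"
  shows "eis_group 1\<lparr>carrier := param_subgroup (k, l)\<rparr> \<cong> eis_group (int (gcd k 6))"
proof -
  obtain a b d p q where l: "l = ((a, b, d), (p, q))" by (metis prod.collapse)
  show ?thesis
    using assms unfolding l subgroup_params_iff[OF assms(1)] param_subgroup_def
    by (auto intro!: eis_group.iso_sym screw_subgroup_lat_iso)
qed

text \<open>The parametrisation turns the isomorphism type into a condition on the screw step; that
  no other step contributes is \<open>eis_group_iso_imp_eq\<close>.\<close>

lemma num_subgroups_iso_eis_group:
  assumes n: "n > 0" and j: "j \<in> {1, 2, 3, 6}"
  shows "num_subgroups_iso (eis_group (int j)) (eis_group 1) n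
    = (\<Sum>k | gcd (n div k) 6 = j \<and> k dvd n. k * card (hnf_lattices (n div k) k))"
proof -
  let ?A = "{D \<in> subgroups_of_index (eis_group 1) n. eis_group 1\<lparr>carrier := D\<rparr> \<cong> eis_group (int j)}"
  have iff: "eis_group 1\<lparr>carrier := param_subgroup x\<rparr> \<cong> eis_group (int j) \<longleftrightarrow> gcd (fst x) 6 = j"
    if "x \<in> subgroup_params UNIV n" for x
  proof -
    obtain k l where x: "x = (k, l)" by (meson surj_pair)
    note iso = param_subgroup_iso[OF n that[unfolded x]]
    have "subgroup (param_subgroup x) (eis_group 1)"
      using bij_betw_param_subgroup[OF n] that by (auto simp: bij_betw_def subgroups_of_index_def)
    then have "group (eis_group 1\<lparr>carrier := param_subgroup x\<rparr>)"
      by (rule subgroup.subgroup_is_group[OF _ group_eis_group])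
    note sym = group.iso_sym[OF this]
    have "int (gcd k 6) = int j" if "eis_group 1\<lparr>carrier := param_subgroup x\<rparr> \<cong> eis_group (int j)"
    proof (rule eis_group_iso_imp_eq)
      show "eis_group (int (gcd k 6)) \<cong> eis_group (int j)"
        using sym[OF iso[folded x]] that by (rule iso_trans)
    qed (use j in \<open>auto simp: gcd_6_eq\<close>)
    then show ?thesis using iso by (auto simp: x)
  qed
  have bij: "bij_betw param_subgroup (subgroup_params UNIV n) (subgroups_of_index (eis_group 1) n)"
    by (rule bij_betw_param_subgroup[OF n])
  have eq: "subgroup_params {k. gcd k 6 = j} n = {x \<in> subgroup_params UNIV n. gcd (fst x) 6 = j}"
    by (auto simp: subgroup_params_def)
  have "bij_betw param_subgroup (subgroup_params {k. gcd k 6 = j} n) ?A"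
    unfolding eq by (rule bij_betw_Collect[OF bij]) (simp add: iff)
  then have "card ?A = card (subgroup_params {k. gcd k 6 = j} n)"
    by (rule bij_betw_same_card[symmetric])
  then show ?thesis
    by (simp add: num_subgroups_iso_def card_subgroup_params[OF n])
qed

section \<open>Transport along isomorphisms\<close>

lemma iso_image_r_coset:
  assumes h: "h \<in> iso G H" and D: "D \<subseteq> carrier G" and g: "g \<in> carrier G"
  shows "h ` (D #>\<^bsub>G\<^esub> g) = (h ` D) #>\<^bsub>H\<^esub> h g"
proof -
  have "h (x \<otimes>\<^bsub>G\<^esub> g) = h x \<otimes>\<^bsub>H\<^esub> h g" if "x \<in> D" for x
    using h that D g by (auto simp: iso_def intro: hom_mult)
  then show ?thesis by (auto simp: r_coset_def image_iff)
qed

lemma card_rcosets_iso: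
  assumes h: "h \<in> iso G H" and G: "group G" and D: "subgroup D G"
  shows "card (rcosets\<^bsub>H\<^esub> (h ` D)) = card (rcosets\<^bsub>G\<^esub> D)"
proof -
  have DG: "D \<subseteq> carrier G" using D by (rule subgroup.subset)
  have surj: "h ` carrier G = carrier H" and inj: "inj_on h (carrier G)" using h by (simp_all add: iso_iff)
  have "rcosets\<^bsub>H\<^esub> (h ` D) = (\<lambda>g. (h ` D) #>\<^bsub>H\<^esub> h g) ` carrier G"
    by (auto simp: RCOSETS_def simp flip: surj)
  also have "\<dots> = (\<lambda>g. h ` (D #>\<^bsub>G\<^esub> g)) ` carrier G"
    using iso_image_r_coset[OF h DG] by (intro image_cong) auto
  also have "\<dots> = (`) h ` (rcosets\<^bsub>G\<^esub> D)" by (auto simp: RCOSETS_def)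
  finally have "rcosets\<^bsub>H\<^esub> (h ` D) = (`) h ` (rcosets\<^bsub>G\<^esub> D)" .
  moreover have "inj_on ((`) h) (rcosets\<^bsub>G\<^esub> D)"
  proof (rule inj_on_subset)
    show "inj_on ((`) h) (Pow (carrier G))" using inj by (rule inj_on_image_Pow)
    show "rcosets\<^bsub>G\<^esub> D \<subseteq> Pow (carrier G)"
      using group.rcosets_subset_PowG[OF G D] by simp
  qed
  ultimately show ?thesis by (simp add: card_image)
qed

lemma iso_image_subgroups_of_index:
  assumes h: "h \<in> iso G H" and G: "group G" and H: "group H" and D: "D \<in> subgroups_of_index G n"
  shows "h ` D \<in> subgroups_of_index H n" "G\<lparr>carrier := D\<rparr> \<cong> H\<lparr>carrier := h ` D\<rparr>"
proof -
  have sub: "subgroup D G" using D by (simp add: subgroups_of_index_def)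
  have "group_hom G H h"
    using h G H by (auto simp: group_hom_def group_hom_axioms_def iso_def)
  then have "subgroup (h ` D) H" using sub by (rule group_hom.subgroup_img_is_subgroup)
  then show "h ` D \<in> subgroups_of_index H n"
    using D card_rcosets_iso[OF h G sub] by (simp add: subgroups_of_index_def)
  show "G\<lparr>carrier := D\<rparr> \<cong> H\<lparr>carrier := h ` D\<rparr>"
    using iso_restrict[OF h G H sub] by (rule is_isoI)
qed

lemma bij_betw_subgroups_of_index:
  assumes h: "h \<in> iso G H" and G: "group G" and H: "group H"
  shows "bij_betw ((`) h) (subgroups_of_index G n) (subgroups_of_index H n)"
proof (rule bij_betwI')
  have inj: "inj_on h (carrier G)" using h by (simp add: iso_iff)
  fix D E assume "D \<in> subgroups_of_index G n" "E \<in> subgroups_of_index G n"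
  then have "D \<subseteq> carrier G" "E \<subseteq> carrier G"
    by (auto simp: subgroups_of_index_def dest: subgroup.subset)
  then show "(h ` D = h ` E) = (D = E)" using inj by (rule inj_on_image_eq_iff[rotated])
next
  fix D assume "D \<in> subgroups_of_index G n"
  then show "h ` D \<in> subgroups_of_index H n" by (rule iso_image_subgroups_of_index[OF h G H])
next
  fix E assume E: "E \<in> subgroups_of_index H n"
  let ?g = "inv_into (carrier G) h"
  have "?g \<in> iso H G" by (rule group.iso_set_sym[OF G h])
  then have "?g ` E \<in> subgroups_of_index G n" by (rule iso_image_subgroups_of_index[OF _ H G E])
  moreover have "E \<subseteq> h ` carrier G"
    using E h by (auto simp: subgroups_of_index_def iso_iff dest: subgroup.subset)
  then have "E = h ` (?g ` E)" by (simp add: image_inv_into_cancel)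
  ultimately show "\<exists>D\<in>subgroups_of_index G n. E = h ` D" by blast
qed

text \<open>An isomorphism carries subgroups to subgroups, preserving index and type, so the count
  may be made in \<open>eis_group 1\<close>.\<close>

lemma num_subgroups_iso_cong:
  assumes iso: "G \<cong> H" "K \<cong> L" and grp: "group G" "group H" "group K"
  shows "num_subgroups_iso K G n = num_subgroups_iso L H n"
proof -
  obtain h where h: "h \<in> iso G H" using iso(1) by (auto simp: is_iso_def)
  have iff: "G\<lparr>carrier := D\<rparr> \<cong> K \<longleftrightarrow> H\<lparr>carrier := h ` D\<rparr> \<cong> L" if D: "D \<in> subgroups_of_index G n" for D
  proof -
    have "subgroup D G" using D by (simp add: subgroups_of_index_def)
    then have gD: "group (G\<lparr>carrier := D\<rparr>)" using grp(1) by (rule subgroup.subgroup_is_group)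
    note hD = iso_image_subgroups_of_index(2)[OF h grp(1,2) D]
    show ?thesis
      using hD group.iso_sym[OF gD hD] iso(2) group.iso_sym[OF grp(3) iso(2)] iso_trans by metis
  qed
  have "bij_betw ((`) h) {D \<in> subgroups_of_index G n. G\<lparr>carrier := D\<rparr> \<cong> K}
      {D \<in> subgroups_of_index H n. H\<lparr>carrier := D\<rparr> \<cong> L}"
    by (rule bij_betw_Collect[OF bij_betw_subgroups_of_index[OF h grp(1,2)]]) (simp add: iff)
  then show ?thesis unfolding num_subgroups_iso_def by (rule bij_betw_same_card)
qed

section \<open>Evaluation\<close>

text \<open>If \<open>m\<close> does not divide \<open>n\<close>, both sides vanish: no multiple of
  \<open>m\<close> divides \<open>n\<close>.\<close>

lemma at_quotient_divisor_sum:
  assumes "n > 0" "m > 0"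
  shows "at_quotient (\<lambda>m. \<Sum>k | k dvd m. f k) n m = (\<Sum>k | m * k dvd n. f k)"
proof (cases "m dvd n")
  case True
  then have "k dvd n div m \<longleftrightarrow> m * k dvd n" for k
    using assms(2) by (auto elim!: dvdE)
  with True show ?thesis by (simp add: at_quotient_def)
next
  case False
  then have "{k. m * k dvd n} = {}" by (auto dest: dvd_mult_left)
  with False show ?thesis by (simp add: at_quotient_def)
qed

lemma mult_dvd_iff_dvd_div:
  fixes n k m :: nat
  assumes "n > 0" shows "m * k dvd n \<longleftrightarrow> k dvd n \<and> m dvd n div k"
  using assms by (auto elim!: dvdE simp: mult.commute[of _ k] dest: dvd_mult_right)

text \<open>For \<open>j = 2\<close> or \<open>j = 3\<close>, the gcd is \<open>j\<close> exactly if
  \<open>j\<close> but not 6 divides the number. This is the origin of the differences in the second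
  and third counts.\<close>

lemma sum_gcd_6_eq_diff:
  fixes f :: "nat \<Rightarrow> 'a::ab_group_add"
  assumes n: "n > 0" and j: "j = 2 \<or> j = 3"
  shows "(\<Sum>k | gcd (n div k) 6 = j \<and> k dvd n. f k) = (\<Sum>k | j * k dvd n. f k) - (\<Sum>k | 6 * k dvd n. f k)"
proof -
  have "{k. gcd (n div k) 6 = j \<and> k dvd n} = {k. j * k dvd n} - {k. 6 * k dvd n}"
    using j unfolding gcd_6_eq mult_dvd_iff_dvd_div[OF n] by (auto; presburger)
  moreover have "finite {k. j * k dvd n}"
    by (rule finite_subset[of _ "{k. k dvd n}"]) (use n in \<open>auto dest: dvd_mult_right\<close>)
  moreover have "6 dvd c \<Longrightarrow> j dvd c" for c using j by presburger
  then have "{k. 6 * k dvd n} \<subseteq> {k. j * k dvd n}" by (auto simp: mult_dvd_iff_dvd_div[OF n])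
  ultimately show ?thesis by (simp add: sum_diff)
qed

lemma gcd_6_eq_6_iff: "gcd k 6 = (6::nat) \<longleftrightarrow> 6 dvd k"
  by (simp add: gcd_6_eq)

lemma group_pi1_G5: "group pi1_G5" and group_pi1_G3: "group pi1_G3" and group_pi1_G2: "group pi1_G2"
  by (simp_all add: pi1_G5_def pi1_G3_def pi1_G2_def group_presented_group)

lemma group_pi1_G1: "group pi1_G1"
  by (simp add: pi1_G1_def DirProd_group)

lemma subgroup_pi1_G5_iso:
  assumes n: "n > 0" and D: "D \<in> subgroups_of_index pi1_G5 n"
  shows "pi1_G5\<lparr>carrier := D\<rparr> \<cong> pi1_G5 \<or> pi1_G5\<lparr>carrier := D\<rparr> \<cong> pi1_G3
    \<or> pi1_G5\<lparr>carrier := D\<rparr> \<cong> pi1_G2 \<or> pi1_G5\<lparr>carrier := D\<rparr> \<cong> pi1_G1"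
proof -
  obtain h where h: "h \<in> iso pi1_G5 (eis_group 1)"
    using pi1_G5_iso_eis_group by (auto simp: is_iso_def)
  note hD = iso_image_subgroups_of_index[OF h group_pi1_G5 group_eis_group D]
  then have "h ` D \<in> param_subgroup ` subgroup_params UNIV n"
    by (simp only: bij_betw_imp_surj_on[OF bij_betw_param_subgroup[OF n]])
  then obtain x where x: "x \<in> subgroup_params UNIV n" "h ` D = param_subgroup x" by blast
  moreover obtain k l where "x = (k, l)" by (meson surj_pair)
  ultimately have kl: "(k, l) \<in> subgroup_params UNIV n" "h ` D = param_subgroup (k, l)" by simp_all
  have *: "pi1_G5\<lparr>carrier := D\<rparr> \<cong> eis_group (int (gcd k 6))"
    using hD(2) param_subgroup_iso[OF n kl(1)] unfolding kl(2) by (rule iso_trans)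
  have "gcd k 6 = 1 \<or> gcd k 6 = 2 \<or> gcd k 6 = 3 \<or> gcd k 6 = 6" by (simp add: gcd_6_eq)
  then show ?thesis
  proof (elim disjE)
    assume "gcd k 6 = 1"
    with * have "pi1_G5\<lparr>carrier := D\<rparr> \<cong> eis_group 1" by simp
    then show ?thesis
      using iso_trans group.iso_sym[OF group_pi1_G5 pi1_G5_iso_eis_group] by blast
  next
    assume "gcd k 6 = 2"
    with * have "pi1_G5\<lparr>carrier := D\<rparr> \<cong> eis_group 2" by simp
    then show ?thesis
      using iso_trans group.iso_sym[OF group_pi1_G3 pi1_G3_iso_eis_group] by blast
  next
    assume "gcd k 6 = 3"
    with * have "pi1_G5\<lparr>carrier := D\<rparr> \<cong> eis_group 3" by simp
    then show ?thesis
      using iso_trans group.iso_sym[OF group_pi1_G2 pi1_G2_iso_eis_group] by blast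
  next
    assume "gcd k 6 = 6"
    with * have "pi1_G5\<lparr>carrier := D\<rparr> \<cong> eis_group 6" by simp
    then show ?thesis
      using iso_trans group.iso_sym[OF group_pi1_G1 pi1_G1_iso_eis_group] by blast
  qed
qed

lemma num_subgroups_iso_pi1_G5:
  assumes "n > 0" "j \<in> {1, 2, 3, 6}" "group K" "K \<cong> eis_group (int j)"
  shows "num_subgroups_iso K pi1_G5 n
    = (\<Sum>k | gcd (n div k) 6 = j \<and> k dvd n. k * card (hnf_lattices (n div k) k))"
  using num_subgroups_iso_cong[OF pi1_G5_iso_eis_group assms(4) group_pi1_G5 group_eis_group assms(3), of n]
    num_subgroups_iso_eis_group[OF assms(1,2)] by simp

text \<open>Guarantees that the cardinalities are genuine counts, since \<open>card\<close> is 0 on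
  infinite sets.\<close>

lemma finite_subgroups_of_index_pi1_G5:
  assumes n: "n > 0" shows "finite (subgroups_of_index pi1_G5 n)"
proof -
  obtain h where "h \<in> iso pi1_G5 (eis_group 1)"
    using pi1_G5_iso_eis_group by (auto simp: is_iso_def)
  then have "finite (subgroups_of_index pi1_G5 n) \<longleftrightarrow> finite (subgroups_of_index (eis_group 1) n)"
    by (intro bij_betw_finite[OF bij_betw_subgroups_of_index[OF _ group_pi1_G5 group_eis_group]])
  also have "\<dots> \<longleftrightarrow> finite (subgroup_params UNIV n)"
    by (rule bij_betw_finite[OF bij_betw_param_subgroup[OF n], symmetric])
  finally show ?thesis using finite_subgroup_params[OF n] by blast
qed

text \<open>Here \<open>k\<close> is the lattice index and \<open>n div k\<close> the screw step,
  whose gcd with 6 is prime to 3, so only ideals are counted.\<close>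

lemma sum_hnf_lattices_theta:
  assumes n: "n > 0" and j: "\<not> 3 dvd j"
  shows "int (\<Sum>k | gcd (n div k) 6 = j \<and> k dvd n. k * card (hnf_lattices (n div k) k))
    = (\<Sum>k | gcd (n div k) 6 = j \<and> k dvd n. int k * theta k)"
  unfolding of_nat_sum
proof (intro sum.cong)
  fix k assume "k \<in> {k. gcd (n div k) 6 = j \<and> k dvd n}"
  then have "\<not> 3 dvd n div k" "k > 0" using n j by (auto intro: Nat.gr0I)
  then show "int (k * card (hnf_lattices (n div k) k)) = int k * theta k"
    by (simp add: card_hnf_lattices_not_3_dvd)
qed simp

lemma sum_hnf_lattices_sigma1:
  assumes n: "n > 0" and j: "3 dvd j"
  shows "(\<Sum>k | gcd (n div k) 6 = j \<and> k dvd n. k * card (hnf_lattices (n div k) k))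
    = (\<Sum>k | gcd (n div k) 6 = j \<and> k dvd n. k * sigma1 k)"
proof (intro sum.cong)
  fix k assume "k \<in> {k. gcd (n div k) 6 = j \<and> k dvd n}"
  then have "3 dvd n div k" "k > 0" using n j by (auto intro: Nat.gr0I)
  then show "k * card (hnf_lattices (n div k) k) = k * sigma1 k"
    by (simp add: card_hnf_lattices_3_dvd)
qed simp

theorem theorem3:
  fixes n :: nat
  assumes "n > 0"
  shows "(\<forall>D \<in> subgroups_of_index pi1_G5 n.
            pi1_G5\<lparr>carrier := D\<rparr> \<cong> pi1_G5 \<or>
            pi1_G5\<lparr>carrier := D\<rparr> \<cong> pi1_G3 \<or>
            pi1_G5\<lparr>carrier := D\<rparr> \<cong> pi1_G2 \<or>
            pi1_G5\<lparr>carrier := D\<rparr> \<cong> pi1_G1)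
       \<and> finite (subgroups_of_index pi1_G5 n)
       \<and> int (num_subgroups_iso pi1_G5 pi1_G5 n) =
            (\<Sum>k | k dvd n \<and> coprime (n div k) 6. int k * theta k)
       \<and> int (num_subgroups_iso pi1_G3 pi1_G5 n) =
            at_quotient (\<lambda>m. \<Sum>k | k dvd m. int k * theta k) n 2
          - at_quotient (\<lambda>m. \<Sum>k | k dvd m. int k * theta k) n 6
       \<and> int (num_subgroups_iso pi1_G2 pi1_G5 n) =
            int (at_quotient omega n 3) - int (at_quotient omega n 6)
       \<and> num_subgroups_iso pi1_G1 pi1_G5 n = at_quotient omega n 6"
proof -
  have 1: "int (num_subgroups_iso pi1_G5 pi1_G5 n) = (\<Sum>k | k dvd n \<and> coprime (n div k) 6. int k * theta k)"
  proof -
    have "int (num_subgroups_iso pi1_G5 pi1_G5 n) = (\<Sum>k | gcd (n div k) 6 = 1 \<and> k dvd n. int k * theta k)"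
      using sum_hnf_lattices_theta[OF assms, of 1]
      by (subst num_subgroups_iso_pi1_G5[OF assms _ group_pi1_G5, of 1]) (simp_all add: pi1_G5_iso_eis_group)
    then show ?thesis by (simp only: coprime_iff_gcd_eq_1 conj_commute)
  qed
  have 2: "int (num_subgroups_iso pi1_G3 pi1_G5 n) =
      at_quotient (\<lambda>m. \<Sum>k | k dvd m. int k * theta k) n 2 - at_quotient (\<lambda>m. \<Sum>k | k dvd m. int k * theta k) n 6"
  proof -
    have "int (num_subgroups_iso pi1_G3 pi1_G5 n) = (\<Sum>k | gcd (n div k) 6 = 2 \<and> k dvd n. int k * theta k)"
      using sum_hnf_lattices_theta[OF assms, of 2]
      by (subst num_subgroups_iso_pi1_G5[OF assms _ group_pi1_G3, of 2]) (simp_all add: pi1_G3_iso_eis_group)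
    also have "\<dots> = (\<Sum>k | 2 * k dvd n. int k * theta k) - (\<Sum>k | 6 * k dvd n. int k * theta k)"
      by (rule sum_gcd_6_eq_diff[OF assms]) simp
    finally show ?thesis by (simp add: at_quotient_divisor_sum[OF assms])
  qed
  have omega: "at_quotient omega n m = (\<Sum>k | m * k dvd n. k * sigma1 k)" if "m > 0" for m
    using at_quotient_divisor_sum[OF assms that, of "\<lambda>k. k * sigma1 k"]
    by (simp add: omega_def[abs_def])
  have 3: "int (num_subgroups_iso pi1_G2 pi1_G5 n) = int (at_quotient omega n 3) - int (at_quotient omega n 6)"
  proof -
    have "num_subgroups_iso pi1_G2 pi1_G5 n = (\<Sum>k | gcd (n div k) 6 = 3 \<and> k dvd n. k * sigma1 k)"
      using sum_hnf_lattices_sigma1[OF assms, of 3]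
      by (subst num_subgroups_iso_pi1_G5[OF assms _ group_pi1_G2, of 3]) (simp_all add: pi1_G2_iso_eis_group)
    then have "int (num_subgroups_iso pi1_G2 pi1_G5 n)
        = (\<Sum>k | gcd (n div k) 6 = 3 \<and> k dvd n. int (k * sigma1 k))" by simp
    also have "\<dots> = (\<Sum>k | 3 * k dvd n. int (k * sigma1 k)) - (\<Sum>k | 6 * k dvd n. int (k * sigma1 k))"
      by (rule sum_gcd_6_eq_diff[OF assms]) simp
    finally show ?thesis by (simp add: omega)
  qed
  have 4: "num_subgroups_iso pi1_G1 pi1_G5 n = at_quotient omega n 6"
  proof -
    have "num_subgroups_iso pi1_G1 pi1_G5 n = (\<Sum>k | gcd (n div k) 6 = 6 \<and> k dvd n. k * sigma1 k)"
      using sum_hnf_lattices_sigma1[OF assms, of 6]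
      by (subst num_subgroups_iso_pi1_G5[OF assms _ group_pi1_G1, of 6]) (simp_all add: pi1_G1_iso_eis_group)
    also have "{k. gcd (n div k) 6 = 6 \<and> k dvd n} = {k. 6 * k dvd n}"
      unfolding gcd_6_eq_6_iff mult_dvd_iff_dvd_div[OF assms] by blast
    finally show ?thesis by (simp add: omega)
  qed
  show ?thesis
    using subgroup_pi1_G5_iso[OF assms] finite_subgroups_of_index_pi1_G5[OF assms] 1 2 3 4 by blast
qed

end
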